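(* Let $\bar{x}\in\mathcal{F}$ be a locally optimal solution of (MPSC). Assume that the MPSC piecewise constant rank of subspace component condition (MPSC-PCRSC) holds at $\bar{x}$. Then the penalty problem admits a local exact penalization at $\bar{x}$: there exists $\bar\kappa>0$ such that $\bar{x}$ is a locally optimal solution of the penalty problem with parameter $\kappa$ for all $\kappa>\bar\kappa$.
   Context: (MPSC) is the problem: minimize $f(x)$ over $x\in\mathbb{R}^n$ subject to $g_i(x)\le 0$ ($i=1,\dots,m$), $h_j(x)=0$ ($j=1,\dots,p$), $G_k(x)H_k(x)=0$ ($k=1,\dots,l$), where $f,g_i,h_j,G_k,H_k:\mathbb{R}^n\to\mathbb{R}$ are twice continuously differentiable. $\mathcal{F}$ denotes its feasible set. For a feasible point $\bar{x}$: $\mathcal{I}_h=\{1,\dots,p\}$, $\mathcal{I}_g=\{i: g_i(\bar{x})=0\}$, $\mathcal{I}_G=\{k: G_k(\bar{x})=0,\,H_k(\bar{x})\neq0\}$, $\mathcal{I}_H=\{k: G_k(\bar{x})\ne0,\,H_k(\bar{x})=0\}$, $\mathcal{I}_{GH}=\{k: G_k(\bar{x})=H_k(\bar{x})=0\}$. $\mathcal{P}(\mathcal{I}_{GH})$ is the set of all pairs $(\beta_1,\beta_2)$ of disjoint (possibly empty) sets with $\beta_1\cup\beta_2=\mathcal{I}_{GH}$. MPSC-PCRSC holds at $\bar{x}$ if for each $(\beta_1,\beta_2)\in\mathcal{P}(\mathcal{I}_{GH})$ there is $\varepsilon>0$ such that the rank of the family $\{\nabla g_i(x)\}_{i\in\mathcal{I}_g^-}\cup\{\nabla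 h_j(x)\}_{j\in\mathcal{I}_h}\cup\{\nabla G_k(x)\}_{k\in\mathcal{I}_G\cup\beta_1}\cup\{\nabla H_k(x)\}_{k\in\mathcal{I}_H\cup\beta_2}$ is constant for all $x$ with $\|x-\bar{x}\|<\varepsilon$. Here $\mathcal{I}_g^-$ (depending on $(\beta_1,\beta_2)$) is the set of $r\in\mathcal{I}_g$ such that $-\nabla g_r(\bar{x})$ can be written as $\sum_{i\in\mathcal{I}_g\setminus\{r\}}\lambda_i\nabla g_i(\bar{x})+\sum_{j=1}^p\rho_j\nabla h_j(\bar{x})+\sum_{k\in\mathcal{I}_G\cup\beta_1}\mu_k\nabla G_k(\bar{x})+\sum_{k\in\mathcal{I}_H\cup\beta_2}\nu_k\nabla H_k(\bar{x})$ with $\lambda_i\ge0$ and $\rho_j,\mu_k,\nu_k\in\mathbb{R}$. The penalty problem with parameter $\kappa>0$ is: minimize over $x\in\mathbb{R}^n$ the function $$f(x)+\kappa\Big(\sum_{i=1}^m[g_i^+(x)]^2+\sum_{j=1}^p[h_j(x)]^2+\sum_{k=1}^l\min\{[G_k(x)]^2,[H_k(x)]^2\}\Big)^{1/2},\qquad g_i^+(x)=\max\{g_i(x),0\}.$$ *)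

theory Defs
  imports "HOL-Analysis.Analysis"
begin

definition gradient :: "('a::real_inner \<Rightarrow> real) \<Rightarrow> 'a \<Rightarrow> 'a" where
  "gradient f x = (THE D. GDERIV f x :> D)"

lemma gradient_eqI:
  assumes "GDERIV f x :> D"
  shows "gradient f x = D"
  unfolding gradient_def
proof (rule the_equality)
  fix D' assume "GDERIV f x :> D'"
  with assms have "(\<lambda>h. h \<bullet> D') = (\<lambda>h. h \<bullet> D)"
    unfolding gderiv_def by (rule has_derivative_unique[rotated])
  then show "D' = D"
    by (metis vector_eq_ldot)
qed (rule assms)

definition twice_continuously_differentiable :: "('a::euclidean_space \<Rightarrow> real) \<Rightarrow> bool" where
  "twice_continuously_differentiable f \<longleftrightarrow>
     (\<exists>(f' :: 'a \<Rightarrow> 'a) (f'' :: 'a \<Rightarrow> 'a \<Rightarrow>\<^sub>L 'a).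
        (\<forall>x. GDERIV f x :> f' x) \<and>
        (\<forall>x. (f' has_derivative blinfun_apply (f'' x)) (at x)) \<and>
        continuous_on UNIV f'')"

definition locally_optimal :: "('a::metric_space \<Rightarrow> real) \<Rightarrow> 'a set \<Rightarrow> 'a \<Rightarrow> bool" where
  "locally_optimal f S x \<longleftrightarrow>
     x \<in> S \<and> (\<exists>\<epsilon>>0. \<forall>y\<in>S. dist y x < \<epsilon> \<longrightarrow> f x \<le> f y)"

(* The constraint functions are families indexed by nat, of which only the indices 1..m, 1..p
   and 1..l are used; m, p and l may be 0. *)

definition mpsc_feasible ::
  "nat \<Rightarrow> nat \<Rightarrow> nat \<Rightarrow> (nat \<Rightarrow> real^'n \<Rightarrow> real) \<Rightarrow> (nat \<Rightarrow> real^'n \<Rightarrow> real) \<Rightarrow>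
   (nat \<Rightarrow> real^'n \<Rightarrow> real) \<Rightarrow> (nat \<Rightarrow> real^'n \<Rightarrow> real) \<Rightarrow> (real^'n) set" where
  "mpsc_feasible m p l g h G H =
     {x. (\<forall>i\<in>{1..m}. g i x \<le> 0) \<and> (\<forall>j\<in>{1..p}. h j x = 0) \<and>
         (\<forall>k\<in>{1..l}. G k x * H k x = 0)}"

definition I_g :: "nat \<Rightarrow> (nat \<Rightarrow> real^'n \<Rightarrow> real) \<Rightarrow> real^'n \<Rightarrow> nat set" where
  "I_g m g x = {i\<in>{1..m}. g i x = 0}"

definition I_G :: "nat \<Rightarrow> (nat \<Rightarrow> real^'n \<Rightarrow> real) \<Rightarrow> (nat \<Rightarrow> real^'n \<Rightarrow> real) \<Rightarrow> real^'n \<Rightarrow> nat set" where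
  "I_G l G H x = {k\<in>{1..l}. G k x = 0 \<and> H k x \<noteq> 0}"

definition I_H :: "nat \<Rightarrow> (nat \<Rightarrow> real^'n \<Rightarrow> real) \<Rightarrow> (nat \<Rightarrow> real^'n \<Rightarrow> real) \<Rightarrow> real^'n \<Rightarrow> nat set" where
  "I_H l G H x = {k\<in>{1..l}. G k x \<noteq> 0 \<and> H k x = 0}"

definition I_GH :: "nat \<Rightarrow> (nat \<Rightarrow> real^'n \<Rightarrow> real) \<Rightarrow> (nat \<Rightarrow> real^'n \<Rightarrow> real) \<Rightarrow> real^'n \<Rightarrow> nat set" where
  "I_GH l G H x = {k\<in>{1..l}. G k x = 0 \<and> H k x = 0}"

definition bipartitions :: "'a set \<Rightarrow> ('a set \<times> 'a set) set" where
  "bipartitions I = {(\<beta>1, \<beta>2). \<beta>1 \<inter> \<beta>2 = {} \<and> \<beta>1 \<union> \<beta>2 = I}"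

definition I_g_minus ::
  "nat \<Rightarrow> nat \<Rightarrow> nat \<Rightarrow> (nat \<Rightarrow> real^'n \<Rightarrow> real) \<Rightarrow> (nat \<Rightarrow> real^'n \<Rightarrow> real) \<Rightarrow>
   (nat \<Rightarrow> real^'n \<Rightarrow> real) \<Rightarrow> (nat \<Rightarrow> real^'n \<Rightarrow> real) \<Rightarrow> real^'n \<Rightarrow>
   nat set \<Rightarrow> nat set \<Rightarrow> nat set" where
  "I_g_minus m p l g h G H x \<beta>1 \<beta>2 =
     {r \<in> I_g m g x.
        \<exists>(\<alpha> :: nat \<Rightarrow> real) (\<rho> :: nat \<Rightarrow> real) (\<mu> :: nat \<Rightarrow> real) (\<nu> :: nat \<Rightarrow> real).
          (\<forall>i \<in> I_g m g x - {r}. \<alpha> i \<ge> 0) \<and>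
          - gradient (g r) x =
              (\<Sum>i \<in> I_g m g x - {r}. \<alpha> i *\<^sub>R gradient (g i) x) +
              (\<Sum>j \<in> {1..p}. \<rho> j *\<^sub>R gradient (h j) x) +
              (\<Sum>k \<in> I_G l G H x \<union> \<beta>1. \<mu> k *\<^sub>R gradient (G k) x) +
              (\<Sum>k \<in> I_H l G H x \<union> \<beta>2. \<nu> k *\<^sub>R gradient (H k) x)}"

(* The rank of a family of vectors is the dimension of its span, so it depends only on the set
   of its members; dim S is the dimension of span S. All index sets are determined at xb; only
   the gradients move with x. *)

definition mpsc_pcrsc ::
  "nat \<Rightarrow> nat \<Rightarrow> nat \<Rightarrow> (nat \<Rightarrow> real^'n \<Rightarrow> real) \<Rightarrow> (nat \<Rightarrow> real^'n \<Rightarrow> real) \<Rightarrow>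
   (nat \<Rightarrow> real^'n \<Rightarrow> real) \<Rightarrow> (nat \<Rightarrow> real^'n \<Rightarrow> real) \<Rightarrow> real^'n \<Rightarrow> bool" where
  "mpsc_pcrsc m p l g h G H xb \<longleftrightarrow>
     (\<forall>(\<beta>1, \<beta>2) \<in> bipartitions (I_GH l G H xb). \<exists>\<epsilon>>0.
        (\<lambda>x. dim ((\<lambda>i. gradient (g i) x) ` I_g_minus m p l g h G H xb \<beta>1 \<beta>2 \<union>
                  (\<lambda>j. gradient (h j) x) ` {1..p} \<union>
                  (\<lambda>k. gradient (G k) x) ` (I_G l G H xb \<union> \<beta>1) \<union>
                  (\<lambda>k. gradient (H k) x) ` (I_H l G H xb \<union> \<beta>2)))
          constant_on ball xb \<epsilon>)"

definition penalty_objective ::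
  "nat \<Rightarrow> nat \<Rightarrow> nat \<Rightarrow> (real^'n \<Rightarrow> real) \<Rightarrow> (nat \<Rightarrow> real^'n \<Rightarrow> real) \<Rightarrow>
   (nat \<Rightarrow> real^'n \<Rightarrow> real) \<Rightarrow> (nat \<Rightarrow> real^'n \<Rightarrow> real) \<Rightarrow> (nat \<Rightarrow> real^'n \<Rightarrow> real) \<Rightarrow>
   real \<Rightarrow> real^'n \<Rightarrow> real" where
  "penalty_objective m p l f g h G H \<kappa> x =
     f x + \<kappa> * sqrt ((\<Sum>i=1..m. (max (g i x) 0)\<^sup>2) + (\<Sum>j=1..p. (h j x)\<^sup>2) +
                      (\<Sum>k=1..l. min ((G k x)\<^sup>2) ((H k x)\<^sup>2)))"

end

theory Submission
  imports Defs
begin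

text \<open>A bipartition of the biactive indices turns the switching constraints into plain equalities
\<open>G\<^sub>k = 0\<close> or \<open>H\<^sub>k = 0\<close> and so selects an ordinary nonlinear program, a branch, whose
feasible set lies inside that of the original problem. At every point near \<open>xb\<close> the penalty term
equals the norm of the constraint violation of some branch: pick for each biactive \<open>k\<close> the smaller
of \<open>\<bar>G\<^sub>k\<bar>\<close> and \<open>\<bar>H\<^sub>k\<bar>\<close>. As there are finitely many branches, it is enough to have a local
error bound for each of them: the distance to the branch's feasible set is at most a constant times
the violation. A local Lipschitz constant of \<open>f\<close> times the error bound constant is then an exact
penalty parameter (\<open>branch_exact_penalty\<close>).

The error bound (\<open>error_bound\<close>) rests on the constant rank assumption. Let \<open>J\<close> be the set of those
active inequalities that carry a positive weight in some vanishing combination of the gradients with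
nonnegative weights on the inequalities.

First, a family of functions vanishing at \<open>a\<close> whose gradients have constant rank near \<open>a\<close> behaves
like its members with linearly independent gradients at \<open>a\<close>. A local diffeomorphism makes those
members linear; the gradient of any combination \<open>\<psi>\<close> of the family lies in the span of their
gradients, so \<open>\<psi>\<close> varies only as far as they do. If the gradient of \<open>\<psi>\<close> vanishes at \<open>a\<close>, then
\<open>\<psi>\<close> is even negligible against them (\<open>negligible_if_gradient_in_span\<close>).

Secondly, take for \<open>\<psi>\<close> a vanishing combination with positive weights on all of \<open>J\<close>. That \<open>\<psi>\<close> is
negligible means that the negative parts of the inequalities in \<open>J\<close> are controlled by the positive
parts and the equalities. Hence the constraints in \<open>J\<close> are equalities up to a multiple of the
violation (\<open>residual_bound\<close>).

Thirdly, the remaining active inequalities admit a direction along which they decrease strictly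
while the constraints in \<open>J\<close> and the equalities are stationary; this is a separation argument for
the closed cone of the gradients (\<open>strict_descent_direction_exists\<close>). From a point with violation
\<open>v\<close> one moves by a multiple of \<open>v\<close> along this direction and then corrects onto the zero set of the
constant rank family; the correction is too small to spoil the strict decrease.\<close>

section \<open>Continuously differentiable functions\<close>

definition C1_with_gradient :: "('a::real_inner \<Rightarrow> real) \<Rightarrow> ('a \<Rightarrow> 'a) \<Rightarrow> bool" where
  "C1_with_gradient f f' \<longleftrightarrow> (\<forall>x. GDERIV f x :> f' x) \<and> continuous_on UNIV f'"

lemma C1_has_derivative:
  "C1_with_gradient f f' \<Longrightarrow> (f has_derivative (\<lambda>h. h \<bullet> f' x)) (at x within S)"
  unfolding C1_with_gradient_def gderiv_def by (meson has_derivative_at_withinI)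

lemma C1_isCont: "C1_with_gradient f f' \<Longrightarrow> isCont f x"
  using C1_has_derivative[of f f' x UNIV] has_derivative_continuous by blast

lemma C1_gradient_isCont: "C1_with_gradient f f' \<Longrightarrow> isCont f' x"
  unfolding C1_with_gradient_def by (simp add: continuous_on_eq_continuous_at)

lemma C1_sum:
  assumes "\<And>q. q \<in> Q \<Longrightarrow> C1_with_gradient (\<phi> q) (\<phi>' q)"
  shows "C1_with_gradient (\<lambda>x. \<Sum>q\<in>Q. c q * \<phi> q x) (\<lambda>x. \<Sum>q\<in>Q. c q *\<^sub>R \<phi>' q x)"
  unfolding C1_with_gradient_def gderiv_def
proof (intro conjI allI)
  fix x
  show "((\<lambda>x. \<Sum>q\<in>Q. c q * \<phi> q x) has_derivative (\<lambda>h. h \<bullet> (\<Sum>q\<in>Q. c q *\<^sub>R \<phi>' q x))) (at x)"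
    unfolding inner_sum_right inner_scaleR_right
    by (intro has_derivative_sum has_derivative_mult_right C1_has_derivative assms)
  show "continuous_on UNIV (\<lambda>x. \<Sum>q\<in>Q. c q *\<^sub>R \<phi>' q x)"
    using assms unfolding C1_with_gradient_def by (intro continuous_intros) auto
qed

text \<open>Continuity of the gradient upgrades differentiability at \<open>a\<close> to a first-order estimate that is
uniform over pairs of points near \<open>a\<close>: apply the mean value inequality to \<open>f\<close> minus its
linearization at \<open>a\<close>.\<close>
lemma C1_strict_derivative:
  assumes "C1_with_gradient f f'" and "\<epsilon> > 0"
  obtains \<delta> where "\<delta> > 0"
    "\<And>x y. \<lbrakk>x \<in> ball a \<delta>; y \<in> ball a \<delta>\<rbrakk> \<Longrightarrow> \<bar>f x - f y - f' a \<bullet> (x - y)\<bar> \<le> \<epsilon> * norm (x - y)"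
proof -
  obtain \<delta> where "\<delta> > 0" and \<delta>: "\<And>x. x \<in> ball a \<delta> \<Longrightarrow> norm (f' x - f' a) < \<epsilon>"
  proof -
    obtain \<delta> where "\<delta> > 0" "\<forall>x. dist x a < \<delta> \<longrightarrow> dist (f' x) (f' a) < \<epsilon>"
      using C1_gradient_isCont[OF assms(1), of a] \<open>\<epsilon> > 0\<close>
      unfolding continuous_at_eps_delta by (auto simp: dist_norm)
    then show ?thesis using that[of \<delta>] by (simp add: dist_commute dist_norm[symmetric])
  qed
  have "\<bar>f x - f y - f' a \<bullet> (x - y)\<bar> \<le> \<epsilon> * norm (x - y)"
    if "x \<in> ball a \<delta>" "y \<in> ball a \<delta>" for x y
  proof -
    have der: "((\<lambda>z. f z - f' a \<bullet> z) has_derivative (\<lambda>h. h \<bullet> f' z - f' a \<bullet> h)) (at z within ball a \<delta>)" for z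
      by (intro derivative_intros C1_has_derivative[OF assms(1)])
    have on: "onorm (\<lambda>h. h \<bullet> f' z - f' a \<bullet> h) \<le> \<epsilon>" if "z \<in> ball a \<delta>" for z
    proof (rule onorm_bound)
      fix h
      have "norm (h \<bullet> f' z - f' a \<bullet> h) = \<bar>(f' z - f' a) \<bullet> h\<bar>"
        by (simp add: inner_diff_left inner_commute[of h])
      also have "\<dots> \<le> norm (f' z - f' a) * norm h" by (rule Cauchy_Schwarz_ineq2)
      also have "\<dots> \<le> \<epsilon> * norm h" using \<delta>[OF that] by (intro mult_right_mono) auto
      finally show "norm (h \<bullet> f' z - f' a \<bullet> h) \<le> \<epsilon> * norm h" .
    qed (use \<open>\<epsilon> > 0\<close> in simp)
    have "norm ((f x - f' a \<bullet> x) - (f y - f' a \<bullet> y)) \<le> \<epsilon> * norm (x - y)"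
      by (rule differentiable_bound[OF convex_ball der on that])
    then show ?thesis by (simp add: inner_diff_right algebra_simps)
  qed
  with \<open>\<delta> > 0\<close> that show ?thesis by blast
qed

lemma C1_strict_derivative_finite:
  assumes "finite Q" and "\<And>q. q \<in> Q \<Longrightarrow> C1_with_gradient (\<phi> q) (\<phi>' q)" and "\<epsilon> > 0"
  obtains \<delta> where "\<delta> > 0"
    "\<And>q x y. \<lbrakk>q \<in> Q; x \<in> ball a \<delta>; y \<in> ball a \<delta>\<rbrakk> \<Longrightarrow>
       \<bar>\<phi> q x - \<phi> q y - \<phi>' q a \<bullet> (x - y)\<bar> \<le> \<epsilon> * norm (x - y)"
proof -
  have "\<forall>q\<in>Q. \<exists>\<delta>>0. \<forall>x\<in>ball a \<delta>. \<forall>y\<in>ball a \<delta>.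
          \<bar>\<phi> q x - \<phi> q y - \<phi>' q a \<bullet> (x - y)\<bar> \<le> \<epsilon> * norm (x - y)"
  proof
    fix q assume "q \<in> Q"
    show "\<exists>\<delta>>0. \<forall>x\<in>ball a \<delta>. \<forall>y\<in>ball a \<delta>.
          \<bar>\<phi> q x - \<phi> q y - \<phi>' q a \<bullet> (x - y)\<bar> \<le> \<epsilon> * norm (x - y)"
      by (rule C1_strict_derivative[OF assms(2)[OF \<open>q \<in> Q\<close>] assms(3), of a]) auto
  qed
  from bchoice[OF this] obtain r where r: "\<And>q. q \<in> Q \<Longrightarrow> r q > 0"
    "\<And>q x y. \<lbrakk>q \<in> Q; x \<in> ball a (r q); y \<in> ball a (r q)\<rbrakk> \<Longrightarrow>
       \<bar>\<phi> q x - \<phi> q y - \<phi>' q a \<bullet> (x - y)\<bar> \<le> \<epsilon> * norm (x - y)" by blast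
  define \<delta> where "\<delta> = Min (insert 1 (r ` Q))"
  have "\<delta> > 0" and le: "\<And>q. q \<in> Q \<Longrightarrow> \<delta> \<le> r q"
    using \<open>finite Q\<close> r(1) by (auto simp: \<delta>_def)
  show ?thesis
  proof (rule that[OF \<open>\<delta> > 0\<close>])
    fix q x y assume q: "q \<in> Q" and "x \<in> ball a \<delta>" "y \<in> ball a \<delta>"
    then have "x \<in> ball a (r q)" "y \<in> ball a (r q)" using le[OF q] by auto
    then show "\<bar>\<phi> q x - \<phi> q y - \<phi>' q a \<bullet> (x - y)\<bar> \<le> \<epsilon> * norm (x - y)" by (rule r(2)[OF q])
  qed
qed

section \<open>Straightening functions with independent gradients\<close>

lemma in_span_image_sum:
  assumes "finite B" and "x \<in> span (w ` B)"
  shows "\<exists>c. x = (\<Sum>b\<in>B. c b *\<^sub>R w b)"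
  using assms(2)
proof (induction rule: span_induct_alt)
  case base
  show ?case by (intro exI[of _ "\<lambda>_. 0"]) simp
next
  case (step r y z)
  then obtain b c where b: "b \<in> B" "y = w b" and z: "z = (\<Sum>b\<in>B. c b *\<^sub>R w b)" by blast
  show ?case
    using b assms(1) unfolding z
    by (intro exI[of _ "\<lambda>q. c q + (if q = b then r else 0)"])
       (simp add: scaleR_add_left sum.distrib if_distrib[of "\<lambda>t. t *\<^sub>R _"] cong: if_cong)
qed

text \<open>The coordinate functionals of an independent set, represented by inner products.\<close>
lemma dual_vectors:
  fixes U :: "'a::euclidean_space set"
  assumes "independent U"
  shows "\<exists>v. \<forall>u\<in>U. \<forall>w\<in>U. w \<bullet> v u = (if w = u then 1 else 0)"
proof (rule bchoice, rule ballI)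
  fix u assume "u \<in> U"
  obtain l :: "'a \<Rightarrow> real" where l: "linear l" "\<And>w. w \<in> U \<Longrightarrow> l w = (if w = u then 1 else 0)"
    using linear_independent_extend[OF assms, of "\<lambda>w. if w = u then 1 else 0"] by blast
  have "w \<bullet> adjoint l 1 = (if w = u then 1 else 0)" if "w \<in> U" for w
    using adjoint_works[OF l(1), of w 1] l(2)[OF that] by simp
  then show "\<exists>y. \<forall>w\<in>U. w \<bullet> y = (if w = u then 1 else 0)" by blast
qed

text \<open>Linear independence of the gradients at \<open>a\<close> enters through vectors \<open>v\<close> dual to them, which also
serve as the directions in which the single functions can be adjusted.\<close>
locale nondegenerate_system =
  fixes B :: "'b set" and F :: "'b \<Rightarrow> 'a::euclidean_space \<Rightarrow> real" and F' :: "'b \<Rightarrow> 'a \<Rightarrow> 'a"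
    and a :: 'a and v :: "'b \<Rightarrow> 'a"
  assumes finite_B: "finite B"
    and C1: "\<And>b. b \<in> B \<Longrightarrow> C1_with_gradient (F b) (F' b)"
    and zero_at: "\<And>b. b \<in> B \<Longrightarrow> F b a = 0"
    and dual: "\<And>b c. \<lbrakk>b \<in> B; c \<in> B\<rbrakk> \<Longrightarrow> F' b a \<bullet> v c = (if b = c then 1 else 0)"
begin

text \<open>A chart around \<open>a\<close> with identity derivative there, in which each \<open>F b\<close> becomes the linear
functional given by its gradient at \<open>a\<close>: the nonlinear remainder of \<open>F b\<close> is added along the dual
vector \<open>v b\<close>.\<close>
definition rectify :: "'a \<Rightarrow> 'a" where
  "rectify x = (x - a) + (\<Sum>b\<in>B. (F b x - F' b a \<bullet> (x - a)) *\<^sub>R v b)"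

lemma rectify_linearizes:
  assumes "b \<in> B"
  shows "F' b a \<bullet> rectify x = F b x"
proof -
  have "(\<Sum>c\<in>B. (F c x - F' c a \<bullet> (x - a)) * (F' b a \<bullet> v c)) = F b x - F' b a \<bullet> (x - a)"
    using assms finite_B by (simp add: dual if_distrib[of "\<lambda>t. _ * t"] cong: if_cong sum.cong)
  then show ?thesis
    by (simp add: rectify_def inner_add_right inner_sum_right)
qed

lemma rectify_base [simp]: "rectify a = 0"
  by (simp add: rectify_def zero_at)

lemma isCont_rectify: "isCont rectify x"
  unfolding rectify_def by (intro continuous_intros C1_isCont) (rule C1)

lemma rectify_local_inverse:
  obtains V \<Gamma> \<Gamma>' where "open V" "0 \<in> V"
    "\<And>y. y \<in> V \<Longrightarrow> (\<Gamma> has_derivative \<Gamma>' y) (at y)"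
    "\<And>y. y \<in> V \<Longrightarrow> rectify (\<Gamma> y) = y"
    "\<forall>\<^sub>F x in nhds a. \<Gamma> (rectify x) = x"
    "(\<Gamma> \<longlongrightarrow> a) (nhds 0)"
proof -
  define D where "D x = id_blinfun + (\<Sum>b\<in>B. blinfun_scaleR_left (v b) o\<^sub>L
                    blinfun_inner_left (F' b x - F' b a))" for x
  have der: "(rectify has_derivative blinfun_apply (D x)) (at x)" for x
  proof -
    have "(rectify has_derivative (\<lambda>h. (h - 0) + (\<Sum>b\<in>B. (h \<bullet> F' b x - F' b a \<bullet> (h - 0)) *\<^sub>R v b))) (at x)"
      unfolding rectify_def
      by (intro has_derivative_add has_derivative_sum has_derivative_scaleR_left has_derivative_diff
          has_derivative_inner_right has_derivative_const has_derivative_ident C1_has_derivative C1)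
    also have "(\<lambda>h. (h - 0) + (\<Sum>b\<in>B. (h \<bullet> F' b x - F' b a \<bullet> (h - 0)) *\<^sub>R v b)) = blinfun_apply (D x)"
      by (auto simp: D_def blinfun.add_left blinfun.sum_left inner_diff_left inner_diff_right inner_commute
           intro!: ext sum.cong)
    finally show ?thesis .
  qed
  have cont: "continuous_on UNIV D"
    unfolding D_def using C1 unfolding C1_with_gradient_def
    by (intro continuous_intros bounded_linear.continuous_on[OF bounded_linear_blinfun_inner_left]) auto
  have inv: "id_blinfun o\<^sub>L D a = id_blinfun"
    by (rule blinfun_eqI) (simp add: D_def blinfun.add_left blinfun.sum_left)
  obtain U V \<Gamma> \<Gamma>' where UV: "open U" "U \<subseteq> UNIV" "a \<in> U" "open V" "rectify a \<in> V"
      "homeomorphism U V rectify \<Gamma>" "\<And>y. y \<in> V \<Longrightarrow> (\<Gamma> has_derivative \<Gamma>' y) (at y)"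
      "\<And>y. y \<in> V \<Longrightarrow> \<Gamma>' y = Hilbert_Choice.inv (blinfun_apply (D (\<Gamma> y)))"
      "\<And>y. y \<in> V \<Longrightarrow> bij (blinfun_apply (D (\<Gamma> y)))"
    by (rule inverse_function_theorem[OF open_UNIV der cont UNIV_I inv], rule that; assumption)
  have \<Gamma>_rectify: "\<Gamma> (rectify x) = x" if "x \<in> U" for x
    using UV(6) that by (simp add: homeomorphism_def)
  have rectify_\<Gamma>: "rectify (\<Gamma> y) = y" if "y \<in> V" for y
    using UV(6) that by (simp add: homeomorphism_def)
  have "0 \<in> V" using UV(5) by simp
  have "\<Gamma> 0 = a" using \<Gamma>_rectify[OF UV(3)] by simp
  moreover have "isCont \<Gamma> 0" using UV(7)[OF \<open>0 \<in> V\<close>] has_derivative_continuous by blast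
  ultimately have lim: "(\<Gamma> \<longlongrightarrow> a) (nhds 0)"
    unfolding isCont_def using tendsto_at_iff_tendsto_nhds by metis
  have "\<forall>\<^sub>F x in nhds a. \<Gamma> (rectify x) = x"
    using eventually_nhds_in_open[OF UV(1,3)] by eventually_elim (rule \<Gamma>_rectify)
  from that[OF UV(4) \<open>0 \<in> V\<close> UV(7) rectify_\<Gamma> this lim] show ?thesis .
qed

text \<open>By strict differentiability the nonlinear part of the chart has Lipschitz constant at most a half
near \<open>a\<close>, which gives the inverse chart the Lipschitz constant 2.\<close>
lemma rectify_expanding:
  "\<exists>\<delta>>0. \<forall>x\<in>ball a \<delta>. \<forall>y\<in>ball a \<delta>. norm (x - y) \<le> 2 * norm (rectify x - rectify y)"
proof -
  define M where "M = (\<Sum>b\<in>B. norm (v b)) + 1"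
  have M: "M > 0" unfolding M_def by (simp add: add_nonneg_pos sum_nonneg)
  obtain \<delta> where "\<delta> > 0" and \<delta>: "\<And>b x y. \<lbrakk>b \<in> B; x \<in> ball a \<delta>; y \<in> ball a \<delta>\<rbrakk> \<Longrightarrow>
          \<bar>F b x - F b y - F' b a \<bullet> (x - y)\<bar> \<le> 1 / (2 * M) * norm (x - y)"
    by (rule C1_strict_derivative_finite[OF finite_B C1, where \<epsilon> = "1 / (2 * M)" and a = a]) (use M in auto)
  have "norm (x - y) \<le> 2 * norm (rectify x - rectify y)"
    if "x \<in> ball a \<delta>" "y \<in> ball a \<delta>" for x y
  proof -
    let ?s = "\<Sum>b\<in>B. (F b x - F b y - F' b a \<bullet> (x - y)) *\<^sub>R v b"
    have eq: "rectify x - rectify y = (x - y) + ?s"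
      by (simp add: rectify_def scaleR_diff_left inner_diff_right sum_subtractf)
    have "norm ?s \<le> (\<Sum>b\<in>B. 1 / (2 * M) * norm (x - y) * norm (v b))"
    proof (rule sum_norm_le)
      fix b assume b: "b \<in> B"
      from \<delta>[OF b that] show "norm ((F b x - F b y - F' b a \<bullet> (x - y)) *\<^sub>R v b) \<le> 1 / (2 * M) * norm (x - y) * norm (v b)"
        unfolding norm_scaleR by (rule mult_right_mono) simp
    qed
    also have "\<dots> = 1 / (2 * M) * norm (x - y) * (M - 1)"
      by (simp add: M_def sum_distrib_left)
    also have "\<dots> \<le> 1 / (2 * M) * norm (x - y) * M"
      using M by (intro mult_left_mono) auto
    also have "\<dots> = norm (x - y) / 2" using M by simp
    finally have "norm ?s \<le> norm (x - y) / 2" .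
    moreover have "norm (x - y) \<le> norm (rectify x - rectify y) + norm ?s"
      unfolding eq using norm_triangle_ineq4[of "x - y + ?s" ?s] by simp
    ultimately show ?thesis by linarith
  qed
  with \<open>\<delta> > 0\<close> show ?thesis by blast
qed

text \<open>Pairing a combination of the gradients at \<open>x\<close> with the dual vectors returns its coefficients up to
a total error of at most half the sum of their absolute values, because the gradients are close to
those at \<open>a\<close>. This shows both that the gradients stay independent near \<open>a\<close> and that small
combinations have small coefficients.\<close>
lemma coefficient_bound:
  "\<forall>\<^sub>F x in nhds a. \<forall>c. (\<Sum>b\<in>B. \<bar>c b\<bar>) \<le> 2 * (\<Sum>k\<in>B. \<bar>(\<Sum>b\<in>B. c b *\<^sub>R F' b x) \<bullet> v k\<bar>)"
proof -
  have "\<forall>b\<in>B. \<forall>\<^sub>F x in nhds a. (\<Sum>k\<in>B. \<bar>(F' b x - F' b a) \<bullet> v k\<bar>) < 1 / 2"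
  proof
    fix b assume "b \<in> B"
    then have "isCont (\<lambda>x. \<Sum>k\<in>B. \<bar>(F' b x - F' b a) \<bullet> v k\<bar>) a"
      by (intro continuous_intros C1_gradient_isCont[OF C1])
    then have "((\<lambda>x. \<Sum>k\<in>B. \<bar>(F' b x - F' b a) \<bullet> v k\<bar>)
        \<longlongrightarrow> (\<Sum>k\<in>B. \<bar>(F' b a - F' b a) \<bullet> v k\<bar>)) (nhds a)"
      unfolding isCont_def by (rule tendsto_at_iff_tendsto_nhds[THEN iffD1])
    then show "\<forall>\<^sub>F x in nhds a. (\<Sum>k\<in>B. \<bar>(F' b x - F' b a) \<bullet> v k\<bar>) < 1 / 2"
      by (rule order_tendstoD) simp
  qed
  then have "\<forall>\<^sub>F x in nhds a. \<forall>b\<in>B. (\<Sum>k\<in>B. \<bar>(F' b x - F' b a) \<bullet> v k\<bar>) < 1 / 2"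
    using finite_B by (simp add: eventually_ball_finite)
  then show ?thesis
  proof eventually_elim
    case (elim x)
    show ?case
    proof
      fix c :: "'b \<Rightarrow> real"
      let ?y = "\<Sum>b\<in>B. c b *\<^sub>R F' b x"
      let ?e = "\<lambda>b k. (F' b x - F' b a) \<bullet> v k"
      have c_eq: "c k = ?y \<bullet> v k - (\<Sum>b\<in>B. c b * ?e b k)" if "k \<in> B" for k
      proof -
        have "(\<Sum>b\<in>B. c b * (F' b a \<bullet> v k)) = c k"
          using that finite_B by (simp add: dual if_distrib[of "\<lambda>t. _ * t"] cong: if_cong sum.cong)
        then show ?thesis
          by (simp add: inner_sum_left inner_diff_left right_diff_distrib sum_subtractf)
      qed
      have "\<bar>c k\<bar> \<le> \<bar>?y \<bullet> v k\<bar> + (\<Sum>b\<in>B. \<bar>c b\<bar> * \<bar>?e b k\<bar>)" if "k \<in> B" for k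
        using c_eq[OF that] sum_abs[of "\<lambda>b. c b * ?e b k" B] unfolding abs_mult by linarith
      then have "(\<Sum>k\<in>B. \<bar>c k\<bar>) \<le> (\<Sum>k\<in>B. \<bar>?y \<bullet> v k\<bar> + (\<Sum>b\<in>B. \<bar>c b\<bar> * \<bar>?e b k\<bar>))"
        by (rule sum_mono)
      also have "\<dots> = (\<Sum>k\<in>B. \<bar>?y \<bullet> v k\<bar>) + (\<Sum>b\<in>B. \<bar>c b\<bar> * (\<Sum>k\<in>B. \<bar>?e b k\<bar>))"
        using sum.swap[of "\<lambda>k b. \<bar>c b\<bar> * \<bar>?e b k\<bar>" B B]
        unfolding sum.distrib sum_distrib_left by simp
      also have "(\<Sum>b\<in>B. \<bar>c b\<bar> * (\<Sum>k\<in>B. \<bar>?e b k\<bar>)) \<le> (\<Sum>b\<in>B. \<bar>c b\<bar> * (1 / 2))"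
        using elim by (intro sum_mono mult_left_mono) (auto intro: less_imp_le)
      also have "\<dots> = (\<Sum>k\<in>B. \<bar>c k\<bar>) / 2" by (simp add: sum_divide_distrib)
      finally show "(\<Sum>b\<in>B. \<bar>c b\<bar>) \<le> 2 * (\<Sum>k\<in>B. \<bar>?y \<bullet> v k\<bar>)" by simp
    qed
  qed
qed

lemma eventually_full_rank:
  "\<forall>\<^sub>F x in nhds a. dim ((\<lambda>b. F' b x) ` B) = card B"
  using coefficient_bound
proof eventually_elim
  case (elim x)
  have zero: "c b = 0" if "(\<Sum>b\<in>B. c b *\<^sub>R F' b x) = 0" "b \<in> B" for c b
  proof -
    have "\<bar>c b\<bar> \<le> (\<Sum>b\<in>B. \<bar>c b\<bar>)"
      using that(2) finite_B by (intro member_le_sum) auto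
    with elim[THEN spec, of c] that(1) show ?thesis by simp
  qed
  have inj: "inj_on (\<lambda>b. F' b x) B"
  proof (rule inj_onI, rule ccontr)
    fix b b' assume b: "b \<in> B" "b' \<in> B" "F' b x = F' b' x" "b \<noteq> b'"
    let ?c = "\<lambda>k. (if k = b then 1 else 0) - (if k = b' then 1 else (0::real))"
    have "(\<Sum>k\<in>B. ?c k *\<^sub>R F' k x) = 0"
      using b finite_B
      by (simp add: scaleR_diff_left sum_subtractf if_distrib[of "\<lambda>t. t *\<^sub>R _"] cong: if_cong)
    from zero[OF this b(1)] b(4) show False by simp
  qed
  have "independent ((\<lambda>b. F' b x) ` B)"
  proof (rule independent_if_scalars_zero)
    fix f y assume "(\<Sum>y\<in>(\<lambda>b. F' b x) ` B. f y *\<^sub>R y) = 0" "y \<in> (\<lambda>b. F' b x) ` B"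
    then show "f y = 0"
      using zero[of "\<lambda>b. f (F' b x)"] by (auto simp: sum.reindex[OF inj])
  qed (use finite_B in simp)
  then show ?case by (simp add: dim_eq_card_independent card_image[OF inj])
qed

text \<open>Join \<open>a\<close> to \<open>x\<close> by the curve that is a straight segment in the rectifying chart. Along it each
\<open>F b\<close> has constant derivative \<open>F b x\<close>, so the derivative of \<open>\<psi>\<close> is the combination of the numbers
\<open>F b x\<close> with the coefficients of \<open>\<psi>'\<close> in terms of the \<open>F' b\<close>. These coefficients are small since
\<open>\<psi>'\<close> is continuous and vanishes at \<open>a\<close>. The mean value theorem finishes the argument.\<close>
lemma negligible_if_gradient_in_span:
  assumes psi: "C1_with_gradient \<psi> \<psi>'" and "\<psi> a = 0" and "\<psi>' a = 0"
    and span: "\<forall>\<^sub>F x in nhds a. \<psi>' x \<in> span ((\<lambda>b. F' b x) ` B)"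
    and "\<epsilon> > 0"
  shows "\<forall>\<^sub>F x in nhds a. \<bar>\<psi> x\<bar> \<le> \<epsilon> * (\<Sum>b\<in>B. \<bar>F b x\<bar>)"
proof -
  have "isCont (\<lambda>x. 2 * (\<Sum>k\<in>B. \<bar>\<psi>' x \<bullet> v k\<bar>)) a"
    by (intro continuous_intros C1_gradient_isCont[OF psi])
  then have "((\<lambda>x. 2 * (\<Sum>k\<in>B. \<bar>\<psi>' x \<bullet> v k\<bar>)) \<longlongrightarrow> 2 * (\<Sum>k\<in>B. \<bar>\<psi>' a \<bullet> v k\<bar>)) (nhds a)"
    unfolding isCont_def by (rule tendsto_at_iff_tendsto_nhds[THEN iffD1])
  then have "\<forall>\<^sub>F x in nhds a. 2 * (\<Sum>k\<in>B. \<bar>\<psi>' x \<bullet> v k\<bar>) < \<epsilon>"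
    using \<open>\<epsilon> > 0\<close> \<open>\<psi>' a = 0\<close> by (intro order_tendstoD) auto
  with span coefficient_bound
  have "\<forall>\<^sub>F x in nhds a. \<exists>c. \<psi>' x = (\<Sum>b\<in>B. c b *\<^sub>R F' b x) \<and> (\<forall>b\<in>B. \<bar>c b\<bar> \<le> \<epsilon>)"
  proof eventually_elim
    case (elim x)
    obtain c where c: "\<psi>' x = (\<Sum>b\<in>B. c b *\<^sub>R F' b x)"
      using in_span_image_sum[OF finite_B elim(1)] by blast
    have "\<bar>c b\<bar> \<le> \<epsilon>" if "b \<in> B" for b
      using member_le_sum[OF that, of "\<lambda>b. \<bar>c b\<bar>"] finite_B elim(2)[THEN spec, of c] elim(3)
      unfolding c by simp
    with c show ?case by blast
  qed
  then obtain N where N: "open N" "a \<in> N"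
    "\<And>x. x \<in> N \<Longrightarrow> \<exists>c. \<psi>' x = (\<Sum>b\<in>B. c b *\<^sub>R F' b x) \<and> (\<forall>b\<in>B. \<bar>c b\<bar> \<le> \<epsilon>)"
    unfolding eventually_nhds by blast
  obtain V \<Gamma> \<Gamma>' where V: "open V" "0 \<in> V"
    and \<Gamma>': "\<And>y. y \<in> V \<Longrightarrow> (\<Gamma> has_derivative \<Gamma>' y) (at y)"
    and rectify_\<Gamma>: "\<And>y. y \<in> V \<Longrightarrow> rectify (\<Gamma> y) = y"
    and \<Gamma>_rectify: "\<forall>\<^sub>F x in nhds a. \<Gamma> (rectify x) = x"
    and \<Gamma>_lim: "(\<Gamma> \<longlongrightarrow> a) (nhds 0)"
    by (rule rectify_local_inverse, rule that; assumption)
  have F_\<Gamma>: "F b (\<Gamma> y) = F' b a \<bullet> y" if "b \<in> B" "y \<in> V" for b y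
    using rectify_linearizes[OF that(1), of "\<Gamma> y"] rectify_\<Gamma>[OF that(2)] by simp
  have "\<Gamma> 0 = a" using eventually_nhds_x_imp_x[OF \<Gamma>_rectify] by simp
  have "\<forall>\<^sub>F y in nhds 0. \<Gamma> y \<in> N" using \<Gamma>_lim N(1,2) by (rule topological_tendstoD)
  moreover have "\<forall>\<^sub>F y in nhds 0. y \<in> V" using V by (rule eventually_nhds_in_open)
  ultimately have "\<forall>\<^sub>F y in nhds 0. y \<in> V \<and> \<Gamma> y \<in> N" by eventually_elim simp
  then obtain r where "r > 0" and r: "\<And>y. dist y 0 < r \<Longrightarrow> y \<in> V \<and> \<Gamma> y \<in> N"
    unfolding eventually_nhds_metric by blast
  have "(rectify \<longlongrightarrow> rectify a) (nhds a)"
    using isCont_rectify unfolding isCont_def by (rule tendsto_at_iff_tendsto_nhds[THEN iffD1])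
  then have "\<forall>\<^sub>F x in nhds a. dist (rectify x) 0 < r"
    unfolding rectify_base using \<open>r > 0\<close> by (rule tendstoD)
  with \<Gamma>_rectify show ?thesis
  proof eventually_elim
    case (elim x)
    define u where "u = rectify x"
    have line: "t *\<^sub>R u \<in> V" "\<Gamma> (t *\<^sub>R u) \<in> N" if "0 \<le> t" "t \<le> 1" for t
    proof -
      have "t * norm u \<le> 1 * norm u" using that by (intro mult_right_mono) auto
      then have "dist (t *\<^sub>R u) 0 < r" using elim(2) that by (simp add: u_def)
      then show "t *\<^sub>R u \<in> V" "\<Gamma> (t *\<^sub>R u) \<in> N" using r by auto
    qed
    have \<Gamma>_line: "((\<lambda>t. \<Gamma> (t *\<^sub>R u)) has_derivative (\<lambda>h. \<Gamma>' (t *\<^sub>R u) (h *\<^sub>R u))) (at t)"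
      if "0 \<le> t" "t \<le> 1" for t
      by (rule has_derivative_compose[where f="\<lambda>t. t *\<^sub>R u", OF _ \<Gamma>'[OF line(1)[OF that]]])
         (auto intro!: derivative_eq_intros)
    have der: "((\<lambda>t. \<psi> (\<Gamma> (t *\<^sub>R u))) has_derivative (\<lambda>h. \<Gamma>' (t *\<^sub>R u) (h *\<^sub>R u) \<bullet> \<psi>' (\<Gamma> (t *\<^sub>R u)))) (at t)"
      if "0 \<le> t" "t \<le> 1" for t
      by (rule has_derivative_compose[OF \<Gamma>_line[OF that] C1_has_derivative[OF psi]])
    have "\<exists>t\<in>{0<..<1}. \<psi> (\<Gamma> (1 *\<^sub>R u)) - \<psi> (\<Gamma> (0 *\<^sub>R u)) =
            \<Gamma>' (t *\<^sub>R u) ((1 - 0) *\<^sub>R u) \<bullet> \<psi>' (\<Gamma> (t *\<^sub>R u))"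
      by (rule mvt_simple[where f="\<lambda>t. \<psi> (\<Gamma> (t *\<^sub>R u))"
            and f'="\<lambda>t h. \<Gamma>' (t *\<^sub>R u) (h *\<^sub>R u) \<bullet> \<psi>' (\<Gamma> (t *\<^sub>R u))"])
         (simp, rule has_derivative_at_withinI, rule der)
    then obtain t where t: "0 < t" "t < 1" and "\<psi> x = \<Gamma>' (t *\<^sub>R u) u \<bullet> \<psi>' (\<Gamma> (t *\<^sub>R u))"
      using \<open>\<Gamma> 0 = a\<close> \<open>\<psi> a = 0\<close> elim(1) by (auto simp: u_def)
    moreover obtain c where "\<psi>' (\<Gamma> (t *\<^sub>R u)) = (\<Sum>b\<in>B. c b *\<^sub>R F' b (\<Gamma> (t *\<^sub>R u)))"
      and c: "\<forall>b\<in>B. \<bar>c b\<bar> \<le> \<epsilon>"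
      using N(3)[OF line(2)[of t]] t by auto
    moreover have "\<Gamma>' (t *\<^sub>R u) u \<bullet> F' b (\<Gamma> (t *\<^sub>R u)) = F b x" if b: "b \<in> B" for b
    proof -
      let ?y = "t *\<^sub>R u"
      have y: "?y \<in> V" using line(1)[of t] t by simp
      have "((\<lambda>y. F b (\<Gamma> y)) has_derivative (\<lambda>h. \<Gamma>' ?y h \<bullet> F' b (\<Gamma> ?y))) (at ?y)"
        by (rule has_derivative_compose[OF \<Gamma>'[OF y] C1_has_derivative[OF C1[OF b]]])
      \<comment> \<open>In the chart \<open>F b\<close> is linear, so its derivative at every point is pairing with \<open>F' b a\<close>.\<close>
      moreover have "((\<lambda>y. F b (\<Gamma> y)) has_derivative (\<lambda>h. F' b a \<bullet> h)) (at ?y)"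
        by (rule has_derivative_transform_within_open[OF _ V(1) y])
           (auto simp: F_\<Gamma>[OF b] intro!: derivative_intros)
      ultimately have "(\<lambda>h. \<Gamma>' ?y h \<bullet> F' b (\<Gamma> ?y)) = (\<lambda>h. F' b a \<bullet> h)"
        by (rule has_derivative_unique)
      then show ?thesis using rectify_linearizes[OF b, of x] by (metis u_def)
    qed
    ultimately have "\<psi> x = (\<Sum>b\<in>B. c b * F b x)"
      by (simp add: inner_sum_right)
    then have "\<bar>\<psi> x\<bar> \<le> (\<Sum>b\<in>B. \<bar>c b\<bar> * \<bar>F b x\<bar>)"
      using sum_abs[of "\<lambda>b. c b * F b x" B] by (simp add: abs_mult)
    also have "\<dots> \<le> (\<Sum>b\<in>B. \<epsilon> * \<bar>F b x\<bar>)"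
      using c by (intro sum_mono mult_right_mono) auto
    finally show ?case by (simp add: sum_distrib_left)
  qed
qed

text \<open>In the rectifying chart, subtracting \<open>F b x\<close> times the dual vector \<open>v b\<close> for all \<open>b\<close> annihilates
all the functions, and the inverse chart is Lipschitz.\<close>
lemma nearby_zero:
  "\<exists>K>0. \<forall>\<eta>>0. \<forall>\<^sub>F x in nhds a. \<exists>x'\<in>ball a \<eta>. (\<forall>b\<in>B. F b x' = 0) \<and>
     dist x x' \<le> K * (\<Sum>b\<in>B. \<bar>F b x\<bar>)"
proof -
  define M where "M = (\<Sum>b\<in>B. norm (v b)) + 1"
  have M: "M > 0" unfolding M_def by (simp add: add_nonneg_pos sum_nonneg)
  obtain \<delta> where "\<delta> > 0"
    and \<delta>: "\<And>x y. \<lbrakk>x \<in> ball a \<delta>; y \<in> ball a \<delta>\<rbrakk> \<Longrightarrow> norm (x - y) \<le> 2 * norm (rectify x - rectify y)"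
    using rectify_expanding by blast
  obtain V \<Gamma> \<Gamma>' where V: "open V" "0 \<in> V"
    and \<Gamma>': "\<And>y. y \<in> V \<Longrightarrow> (\<Gamma> has_derivative \<Gamma>' y) (at y)"
    and rectify_\<Gamma>: "\<And>y. y \<in> V \<Longrightarrow> rectify (\<Gamma> y) = y"
    and \<Gamma>_rectify: "\<forall>\<^sub>F x in nhds a. \<Gamma> (rectify x) = x"
    and \<Gamma>_lim: "(\<Gamma> \<longlongrightarrow> a) (nhds 0)"
    by (rule rectify_local_inverse, rule that; assumption)
  define s where "s x = rectify x - (\<Sum>b\<in>B. F b x *\<^sub>R v b)" for x
  have "isCont s a" unfolding s_def by (intro continuous_intros isCont_rectify C1_isCont) (rule C1)
  moreover have "s a = 0" by (simp add: s_def zero_at)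
  ultimately have s0: "(s \<longlongrightarrow> 0) (nhds a)"
    unfolding isCont_def using tendsto_at_iff_tendsto_nhds by metis
  have "\<forall>\<^sub>F x in nhds a. \<exists>x'\<in>ball a \<eta>. (\<forall>b\<in>B. F b x' = 0) \<and>
     dist x x' \<le> 2 * M * (\<Sum>b\<in>B. \<bar>F b x\<bar>)" if "\<eta> > 0" for \<eta>
  proof -
    have "\<forall>\<^sub>F x in nhds a. s x \<in> V" using s0 V by (rule topological_tendstoD)
    moreover have "\<forall>\<^sub>F x in nhds a. dist (\<Gamma> (s x)) a < min \<delta> \<eta>"
      using filterlim_compose[OF \<Gamma>_lim s0] \<open>\<eta> > 0\<close> \<open>\<delta> > 0\<close> by (intro tendstoD) auto
    moreover have "\<forall>\<^sub>F x in nhds a. dist x a < \<delta>"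
      using \<open>\<delta> > 0\<close> by (auto simp: eventually_nhds_metric)
    ultimately show ?thesis
    proof eventually_elim
      case (elim x)
      let ?x = "\<Gamma> (s x)"
      have rect: "rectify ?x = s x" using rectify_\<Gamma>[OF elim(1)] .
      have "F b ?x = 0" if b: "b \<in> B" for b
      proof -
        have "(\<Sum>c\<in>B. F c x * (F' b a \<bullet> v c)) = F b x"
          using b finite_B by (simp add: dual if_distrib[of "\<lambda>t. _ * t"] cong: if_cong sum.cong)
        then have "F' b a \<bullet> s x = 0"
          using rectify_linearizes[OF b, of x] by (simp add: s_def inner_diff_right inner_sum_right)
        then show ?thesis using rectify_linearizes[OF b, of ?x] rect by simp
      qed
      moreover have "dist x ?x \<le> 2 * M * (\<Sum>b\<in>B. \<bar>F b x\<bar>)"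
      proof -
        have "dist x ?x \<le> 2 * norm (rectify x - rectify ?x)"
          using \<delta>[of x ?x] elim by (simp add: dist_commute[of _ a] flip: dist_norm)
        also have "\<dots> = 2 * norm (\<Sum>b\<in>B. F b x *\<^sub>R v b)" unfolding rect by (simp add: s_def)
        also have "norm (\<Sum>b\<in>B. F b x *\<^sub>R v b) \<le> (\<Sum>b\<in>B. \<bar>F b x\<bar> * M)"
        proof (rule sum_norm_le)
          fix b assume "b \<in> B"
          then have "norm (v b) \<le> M"
            unfolding M_def using member_le_sum[of b B "\<lambda>b. norm (v b)"] finite_B by simp
          then show "norm (F b x *\<^sub>R v b) \<le> \<bar>F b x\<bar> * M" by (simp add: mult_left_mono)
        qed
        also have "\<dots> = M * (\<Sum>b\<in>B. \<bar>F b x\<bar>)" by (simp add: sum_distrib_left mult.commute)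
        finally show ?thesis by simp
      qed
      moreover have "?x \<in> ball a \<eta>" using elim(2) by (simp add: dist_commute)
      ultimately show ?case by blast
    qed
  qed
  then show ?thesis using M by (intro exI[of _ "2 * M"]) auto
qed

end

section \<open>Families of constant rank\<close>

text \<open>Members of the family whose gradients form a basis at \<open>a\<close> keep independent gradients near \<open>a\<close>; by
constancy of the rank these still span all the gradients, so every combination of the family falls
under the preceding results.\<close>
lemma constant_rank_basis:
  fixes \<phi> :: "'q \<Rightarrow> 'a::euclidean_space \<Rightarrow> real"
  assumes "finite Q"
    and C1: "\<And>q. q \<in> Q \<Longrightarrow> C1_with_gradient (\<phi> q) (\<phi>' q)"
    and zero: "\<And>q. q \<in> Q \<Longrightarrow> \<phi> q a = 0"
    and rank: "\<forall>\<^sub>F x in nhds a. dim ((\<lambda>q. \<phi>' q x) ` Q) = dim ((\<lambda>q. \<phi>' q a) ` Q)"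
  obtains B v where "B \<subseteq> Q" "nondegenerate_system B \<phi> \<phi>' a v"
    "\<forall>q\<in>Q. \<phi>' q a \<in> span ((\<lambda>b. \<phi>' b a) ` B)"
    "\<forall>c \<epsilon>. (\<Sum>q\<in>Q. c q *\<^sub>R \<phi>' q a) = 0 \<longrightarrow> \<epsilon> > 0 \<longrightarrow>
       (\<forall>\<^sub>F x in nhds a. \<bar>\<Sum>q\<in>Q. c q * \<phi> q x\<bar> \<le> \<epsilon> * (\<Sum>b\<in>B. \<bar>\<phi> b x\<bar>))"
proof -
  obtain U where U: "U \<subseteq> (\<lambda>q. \<phi>' q a) ` Q" "independent U"
      "(\<lambda>q. \<phi>' q a) ` Q \<subseteq> span U" "card U = dim ((\<lambda>q. \<phi>' q a) ` Q)"
    by (rule basis_exists)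
  obtain B where B: "B \<subseteq> Q" "inj_on (\<lambda>q. \<phi>' q a) B" "U = (\<lambda>q. \<phi>' q a) ` B"
    using U(1) unfolding subset_image_inj by blast
  have "finite B" using B(1) \<open>finite Q\<close> by (rule finite_subset)
  obtain V where V: "\<And>u w. \<lbrakk>u \<in> U; w \<in> U\<rbrakk> \<Longrightarrow> w \<bullet> V u = (if w = u then 1 else 0)"
    using dual_vectors[OF U(2)] by blast
  interpret nondegenerate_system B \<phi> \<phi>' a "\<lambda>b. V (\<phi>' b a)"
  proof
    show "\<phi>' b a \<bullet> V (\<phi>' c a) = (if b = c then 1 else 0)" if "b \<in> B" "c \<in> B" for b c
      using V[of "\<phi>' c a" "\<phi>' b a"] B(2,3) that by (auto dest: inj_onD)
  qed (use \<open>finite B\<close> B(1) C1 zero in auto)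
  have "card B = card U" using B by (simp add: card_image)
  have span: "\<forall>\<^sub>F x in nhds a. (\<lambda>q. \<phi>' q x) ` Q \<subseteq> span ((\<lambda>b. \<phi>' b x) ` B)"
    using rank eventually_full_rank
  proof eventually_elim
    case (elim x)
    have "span ((\<lambda>b. \<phi>' b x) ` B) = span ((\<lambda>q. \<phi>' q x) ` Q)"
      using elim U(4) \<open>card B = card U\<close> B(1) by (intro dim_eq_span) auto
    then show ?case by (simp add: span_superset)
  qed
  have negl: "\<forall>\<^sub>F x in nhds a. \<bar>\<Sum>q\<in>Q. c q * \<phi> q x\<bar> \<le> \<epsilon> * (\<Sum>b\<in>B. \<bar>\<phi> b x\<bar>)"
    if comb: "(\<Sum>q\<in>Q. c q *\<^sub>R \<phi>' q a) = 0" and "\<epsilon> > 0" for c \<epsilon>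
  proof (rule negligible_if_gradient_in_span[OF C1_sum[OF assms(2)] _ comb _ \<open>\<epsilon> > 0\<close>])
    show "(\<Sum>q\<in>Q. c q * \<phi> q a) = 0" using zero by simp
    show "\<forall>\<^sub>F x in nhds a. (\<Sum>q\<in>Q. c q *\<^sub>R \<phi>' q x) \<in> span ((\<lambda>b. \<phi>' b x) ` B)"
      using span by eventually_elim (auto intro!: span_sum span_scale)
  qed
  have "\<forall>q\<in>Q. \<phi>' q a \<in> span ((\<lambda>b. \<phi>' b a) ` B)"
    using eventually_nhds_x_imp_x[OF span] by blast
  then show ?thesis
    using negl by (intro that[OF B(1) nondegenerate_system_axioms]) simp_all
qed

lemma constant_rank_negligible_combination:
  fixes \<phi> :: "'q \<Rightarrow> 'a::euclidean_space \<Rightarrow> real"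
  assumes Q: "finite Q"
    "\<And>q. q \<in> Q \<Longrightarrow> C1_with_gradient (\<phi> q) (\<phi>' q)"
    "\<And>q. q \<in> Q \<Longrightarrow> \<phi> q a = 0"
    "\<forall>\<^sub>F x in nhds a. dim ((\<lambda>q. \<phi>' q x) ` Q) = dim ((\<lambda>q. \<phi>' q a) ` Q)"
    and comb: "(\<Sum>q\<in>Q. c q *\<^sub>R \<phi>' q a) = 0" and "\<epsilon> > 0"
  shows "\<forall>\<^sub>F x in nhds a. \<bar>\<Sum>q\<in>Q. c q * \<phi> q x\<bar> \<le> \<epsilon> * (\<Sum>q\<in>Q. \<bar>\<phi> q x\<bar>)"
proof -
  obtain B v where B: "B \<subseteq> Q" "nondegenerate_system B \<phi> \<phi>' a v"
    and span: "\<forall>q\<in>Q. \<phi>' q a \<in> span ((\<lambda>b. \<phi>' b a) ` B)"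
    and negl: "\<forall>c \<epsilon>. (\<Sum>q\<in>Q. c q *\<^sub>R \<phi>' q a) = 0 \<longrightarrow> \<epsilon> > 0 \<longrightarrow>
       (\<forall>\<^sub>F x in nhds a. \<bar>\<Sum>q\<in>Q. c q * \<phi> q x\<bar> \<le> \<epsilon> * (\<Sum>b\<in>B. \<bar>\<phi> b x\<bar>))"
    by (rule constant_rank_basis[of Q \<phi> \<phi>' a, OF Q])
  have "\<forall>\<^sub>F x in nhds a. \<bar>\<Sum>q\<in>Q. c q * \<phi> q x\<bar> \<le> \<epsilon> * (\<Sum>b\<in>B. \<bar>\<phi> b x\<bar>)"
    using comb \<open>\<epsilon> > 0\<close> negl by simp
  then show ?thesis
  proof eventually_elim
    case (elim x)
    have "(\<Sum>b\<in>B. \<bar>\<phi> b x\<bar>) \<le> (\<Sum>q\<in>Q. \<bar>\<phi> q x\<bar>)"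
      using Q(1) B(1) by (intro sum_mono2) auto
    with elim \<open>\<epsilon> > 0\<close> show ?case by (meson mult_left_mono less_imp_le order_trans)
  qed
qed

lemma sum_single_minus_subset:
  fixes t :: "'q \<Rightarrow> 'z::real_vector"
  assumes "finite Q" "q \<in> Q" "B \<subseteq> Q"
  shows "(\<Sum>k\<in>Q. ((if k = q then 1 else 0) - (if k \<in> B then c k else 0)) *\<^sub>R t k) = t q - (\<Sum>b\<in>B. c b *\<^sub>R t b)"
proof -
  have "(\<Sum>k\<in>Q. (if k \<in> B then c k else 0) *\<^sub>R t k) = (\<Sum>b\<in>B. c b *\<^sub>R t b)"
    using assms by (intro sum.mono_neutral_cong_right) auto
  then show ?thesis
    using assms by (simp add: scaleR_diff_left sum_subtractf if_distrib[of "\<lambda>t. t *\<^sub>R _"] cong: if_cong)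
qed

text \<open>Common zeros of the basic members are zeros of the whole family: subtracting from \<open>\<phi> q\<close> the
combination of basic members with the same gradient at \<open>a\<close> leaves a function dominated by the basic
members.\<close>
lemma constant_rank_nearby_zero:
  fixes \<phi> :: "'q \<Rightarrow> 'a::euclidean_space \<Rightarrow> real"
  assumes Q: "finite Q"
    "\<And>q. q \<in> Q \<Longrightarrow> C1_with_gradient (\<phi> q) (\<phi>' q)"
    "\<And>q. q \<in> Q \<Longrightarrow> \<phi> q a = 0"
    "\<forall>\<^sub>F x in nhds a. dim ((\<lambda>q. \<phi>' q x) ` Q) = dim ((\<lambda>q. \<phi>' q a) ` Q)"
  shows "\<exists>K>0. \<forall>\<eta>>0. \<forall>\<^sub>F x in nhds a. \<exists>x'\<in>ball a \<eta>. (\<forall>q\<in>Q. \<phi> q x' = 0) \<and>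
           dist x x' \<le> K * (\<Sum>q\<in>Q. \<bar>\<phi> q x\<bar>)"
proof -
  obtain B v where B: "B \<subseteq> Q" "nondegenerate_system B \<phi> \<phi>' a v"
    and span: "\<forall>q\<in>Q. \<phi>' q a \<in> span ((\<lambda>b. \<phi>' b a) ` B)"
    and negl: "\<forall>c \<epsilon>. (\<Sum>q\<in>Q. c q *\<^sub>R \<phi>' q a) = 0 \<longrightarrow> \<epsilon> > 0 \<longrightarrow>
       (\<forall>\<^sub>F x in nhds a. \<bar>\<Sum>q\<in>Q. c q * \<phi> q x\<bar> \<le> \<epsilon> * (\<Sum>b\<in>B. \<bar>\<phi> b x\<bar>))"
    by (rule constant_rank_basis[of Q \<phi> \<phi>' a, OF Q])
  interpret nondegenerate_system B \<phi> \<phi>' a v by (rule B(2))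
  have "\<forall>q\<in>Q. \<forall>\<^sub>F x in nhds a. (\<forall>b\<in>B. \<phi> b x = 0) \<longrightarrow> \<phi> q x = 0"
  proof
    fix q assume q: "q \<in> Q"
    obtain c where c: "\<phi>' q a = (\<Sum>b\<in>B. c b *\<^sub>R \<phi>' b a)"
      using in_span_image_sum[OF finite_B span[THEN bspec, OF q]] by blast
    define d where "d k = (if k = q then 1 else 0) - (if k \<in> B then c k else 0)" for k
    have "(\<Sum>k\<in>Q. d k *\<^sub>R \<phi>' k a) = 0"
      using sum_single_minus_subset[OF Q(1) q B(1), of c "\<lambda>k. \<phi>' k a"] c by (simp add: d_def)
    from negl[rule_format, OF this zero_less_one]
    show "\<forall>\<^sub>F x in nhds a. (\<forall>b\<in>B. \<phi> b x = 0) \<longrightarrow> \<phi> q x = 0"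
    proof eventually_elim
      case (elim x)
      have "(\<Sum>k\<in>Q. d k * \<phi> k x) = \<phi> q x - (\<Sum>b\<in>B. c b * \<phi> b x)"
        using sum_single_minus_subset[OF Q(1) q B(1), of c "\<lambda>k. \<phi> k x"] by (simp add: d_def)
      with elim show ?case by auto
    qed
  qed
  then have Q_zero: "\<forall>\<^sub>F x in nhds a. \<forall>q\<in>Q. (\<forall>b\<in>B. \<phi> b x = 0) \<longrightarrow> \<phi> q x = 0"
    using Q(1) by (intro eventually_ball_finite)
  then obtain r where "r > 0" and r: "\<And>x q. \<lbrakk>dist x a < r; q \<in> Q; \<forall>b\<in>B. \<phi> b x = 0\<rbrakk> \<Longrightarrow> \<phi> q x = 0"
    unfolding eventually_nhds_metric by blast
  obtain K where "K > 0" and K: "\<And>\<eta>. \<eta> > 0 \<Longrightarrow> \<forall>\<^sub>F x in nhds a. \<exists>x'\<in>ball a \<eta>. (\<forall>b\<in>B. \<phi> b x' = 0) \<and>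
     dist x x' \<le> K * (\<Sum>b\<in>B. \<bar>\<phi> b x\<bar>)"
    using nearby_zero by blast
  have "\<forall>\<^sub>F x in nhds a. \<exists>x'\<in>ball a \<eta>. (\<forall>q\<in>Q. \<phi> q x' = 0) \<and> dist x x' \<le> K * (\<Sum>q\<in>Q. \<bar>\<phi> q x\<bar>)"
    if "\<eta> > 0" for \<eta>
  proof -
    have "min r \<eta> > 0" using \<open>r > 0\<close> that by simp
    from K[OF this] show ?thesis
    proof eventually_elim
      case (elim x)
      then obtain x' where x': "x' \<in> ball a (min r \<eta>)" "\<forall>b\<in>B. \<phi> b x' = 0"
        "dist x x' \<le> K * (\<Sum>b\<in>B. \<bar>\<phi> b x\<bar>)" by blast
      have "(\<Sum>b\<in>B. \<bar>\<phi> b x\<bar>) \<le> (\<Sum>q\<in>Q. \<bar>\<phi> q x\<bar>)"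
        using Q(1) B(1) by (intro sum_mono2) auto
      then have "dist x x' \<le> K * (\<Sum>q\<in>Q. \<bar>\<phi> q x\<bar>)"
        using x'(3) \<open>K > 0\<close> by (meson mult_left_mono less_imp_le order_trans)
      moreover have "\<forall>q\<in>Q. \<phi> q x' = 0" using r x'(1,2) by (simp add: dist_commute)
      ultimately show ?case using x'(1) by auto
    qed
  qed
  with \<open>K > 0\<close> show ?thesis by blast
qed

section \<open>Positive dependence and descent directions\<close>

text \<open>Equivalently, \<open>- u r\<close> lies in the cone generated by the other \<open>u i\<close> and the \<open>\<plusminus> w e\<close>. The form chosen
here does not single out \<open>r\<close> in the sums, so that combinations for different \<open>r\<close> can be added.\<close>
definition positively_dependent ::
  "'i set \<Rightarrow> 'e set \<Rightarrow> ('i \<Rightarrow> 'a::real_vector) \<Rightarrow> ('e \<Rightarrow> 'a) \<Rightarrow> 'i set" where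
  "positively_dependent I E u w =
     {r \<in> I. \<exists>\<alpha> \<rho>. (\<forall>i\<in>I. 0 \<le> \<alpha> i) \<and> 0 < \<alpha> r \<and>
        (\<Sum>i\<in>I. \<alpha> i *\<^sub>R u i) + (\<Sum>e\<in>E. \<rho> e *\<^sub>R w e) = (0::'a)}"

lemma positively_dependent_iff:
  fixes u :: "'i \<Rightarrow> 'a::real_vector" and w :: "'e \<Rightarrow> 'a"
  assumes "finite I"
  shows "r \<in> positively_dependent I E u w \<longleftrightarrow> r \<in> I \<and>
    (\<exists>\<alpha> \<rho>. (\<forall>i\<in>I - {r}. 0 \<le> \<alpha> i) \<and> - u r = (\<Sum>i\<in>I - {r}. \<alpha> i *\<^sub>R u i) + (\<Sum>e\<in>E. \<rho> e *\<^sub>R w e))"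
  (is "?L \<longleftrightarrow> r \<in> I \<and> ?R")
proof (intro iffI conjI)
  assume ?L
  then obtain \<alpha> \<rho> where r: "r \<in> I" and \<alpha>: "\<forall>i\<in>I. 0 \<le> \<alpha> i" "0 < \<alpha> r"
    and zero: "(\<Sum>i\<in>I. \<alpha> i *\<^sub>R u i) + (\<Sum>e\<in>E. \<rho> e *\<^sub>R w e) = 0"
    unfolding positively_dependent_def by blast
  have "- (\<alpha> r *\<^sub>R u r) = (\<Sum>i\<in>I - {r}. \<alpha> i *\<^sub>R u i) + (\<Sum>e\<in>E. \<rho> e *\<^sub>R w e)"
    using zero sum.remove[OF assms r, of "\<lambda>i. \<alpha> i *\<^sub>R u i"]
    by (intro minus_unique) (simp add: add.assoc)
  then have "(1 / \<alpha> r) *\<^sub>R - (\<alpha> r *\<^sub>R u r) =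
      (1 / \<alpha> r) *\<^sub>R ((\<Sum>i\<in>I - {r}. \<alpha> i *\<^sub>R u i) + (\<Sum>e\<in>E. \<rho> e *\<^sub>R w e))"
    by (rule arg_cong)
  then have "- u r = (\<Sum>i\<in>I - {r}. (\<alpha> i / \<alpha> r) *\<^sub>R u i) + (\<Sum>e\<in>E. (\<rho> e / \<alpha> r) *\<^sub>R w e)"
    using \<alpha>(2) by (simp add: scaleR_add_right scaleR_sum_right)
  then show ?R
    using \<alpha> by (intro exI[of _ "\<lambda>i. \<alpha> i / \<alpha> r"] exI[of _ "\<lambda>e. \<rho> e / \<alpha> r"]) simp
  show "r \<in> I" by (rule r)
next
  assume "r \<in> I \<and> ?R"
  then obtain \<alpha> \<rho> where r: "r \<in> I" and \<alpha>: "\<forall>i\<in>I - {r}. 0 \<le> \<alpha> i"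
    and eq: "- u r = (\<Sum>i\<in>I - {r}. \<alpha> i *\<^sub>R u i) + (\<Sum>e\<in>E. \<rho> e *\<^sub>R w e)" by blast
  have "(\<Sum>i\<in>I. (\<alpha>(r := 1)) i *\<^sub>R u i) = u r + (\<Sum>i\<in>I - {r}. \<alpha> i *\<^sub>R u i)"
    using sum.remove[OF assms r, of "\<lambda>i. (\<alpha>(r := 1)) i *\<^sub>R u i"] by simp
  then have "(\<Sum>i\<in>I. (\<alpha>(r := 1)) i *\<^sub>R u i) + (\<Sum>e\<in>E. \<rho> e *\<^sub>R w e) = 0"
    by (simp add: add.assoc flip: eq)
  then show ?L
    using r \<alpha> unfolding positively_dependent_def mem_Collect_eq
    by (intro conjI exI[of _ "\<alpha>(r := 1)"] exI[of _ \<rho>]) auto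
qed

text \<open>Add up one combination for each index. In the total no index outside the set has a positive weight,
by the definition of the set.\<close>
lemma positive_combination_exists:
  fixes u :: "'i \<Rightarrow> 'a::real_vector" and w :: "'e \<Rightarrow> 'a"
  assumes "finite I"
  obtains \<alpha> \<rho> where "\<forall>i\<in>positively_dependent I E u w. 0 < \<alpha> i"
    "(\<Sum>i\<in>positively_dependent I E u w. \<alpha> i *\<^sub>R u i) + (\<Sum>e\<in>E. \<rho> e *\<^sub>R w e) = 0"
proof -
  let ?J = "positively_dependent I E u w"
  have "?J \<subseteq> I" by (auto simp: positively_dependent_def)
  have "finite ?J" using \<open>?J \<subseteq> I\<close> assms by (rule finite_subset)
  have "\<forall>r\<in>?J. \<exists>\<alpha> \<rho>. (\<forall>i\<in>I. 0 \<le> \<alpha> i) \<and> 0 < \<alpha> r \<and>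
          (\<Sum>i\<in>I. \<alpha> i *\<^sub>R u i) + (\<Sum>e\<in>E. \<rho> e *\<^sub>R w e) = 0"
    by (simp add: positively_dependent_def)
  then obtain A where "\<forall>r\<in>?J. \<exists>\<rho>. (\<forall>i\<in>I. 0 \<le> A r i) \<and> 0 < A r r \<and>
          (\<Sum>i\<in>I. A r i *\<^sub>R u i) + (\<Sum>e\<in>E. \<rho> e *\<^sub>R w e) = 0"
    by (rule bchoice[THEN exE])
  then obtain R where AR: "\<forall>r\<in>?J. (\<forall>i\<in>I. 0 \<le> A r i) \<and> 0 < A r r \<and>
          (\<Sum>i\<in>I. A r i *\<^sub>R u i) + (\<Sum>e\<in>E. R r e *\<^sub>R w e) = 0"
    by (rule bchoice[THEN exE])
  define \<alpha> where "\<alpha> i = (\<Sum>r\<in>?J. A r i)" for i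
  define \<rho> where "\<rho> e = (\<Sum>r\<in>?J. R r e)" for e
  have nonneg: "0 \<le> \<alpha> i" if "i \<in> I" for i
    unfolding \<alpha>_def using AR that by (auto intro: sum_nonneg)
  have pos: "0 < \<alpha> i" if "i \<in> ?J" for i
  proof -
    have "A i i \<le> \<alpha> i"
      unfolding \<alpha>_def using AR that \<open>?J \<subseteq> I\<close> \<open>finite ?J\<close>
      by (intro member_le_sum[where f="\<lambda>r. A r i"]) auto
    moreover have "0 < A i i" using AR that by blast
    ultimately show ?thesis by linarith
  qed
  have "(\<Sum>i\<in>I. \<alpha> i *\<^sub>R u i) + (\<Sum>e\<in>E. \<rho> e *\<^sub>R w e)
      = (\<Sum>r\<in>?J. (\<Sum>i\<in>I. A r i *\<^sub>R u i) + (\<Sum>e\<in>E. R r e *\<^sub>R w e))"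
    using sum.swap[of "\<lambda>i r. A r i *\<^sub>R u i" ?J I] sum.swap[of "\<lambda>e r. R r e *\<^sub>R w e" ?J E]
    by (simp add: \<alpha>_def \<rho>_def scaleR_sum_left sum.distrib)
  also have "\<dots> = 0" using AR by simp
  finally have zero: "(\<Sum>i\<in>I. \<alpha> i *\<^sub>R u i) + (\<Sum>e\<in>E. \<rho> e *\<^sub>R w e) = 0" .
  have "\<alpha> i = 0" if "i \<in> I - ?J" for i
    using zero nonneg that by (auto simp: positively_dependent_def less_le)
  then have "(\<Sum>i\<in>I. \<alpha> i *\<^sub>R u i) = (\<Sum>i\<in>?J. \<alpha> i *\<^sub>R u i)"
    using \<open>?J \<subseteq> I\<close> assms by (intro sum.mono_neutral_right) auto
  with zero have "(\<Sum>i\<in>?J. \<alpha> i *\<^sub>R u i) + (\<Sum>e\<in>E. \<rho> e *\<^sub>R w e) = 0" by simp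
  then show ?thesis using pos by (intro that[of \<alpha> \<rho>]) auto
qed

text \<open>The vector \<open>- u r\<close> does not belong to the cone generated by the \<open>u i\<close> and the \<open>\<plusminus> w e\<close>. A finitely
generated cone is polyhedral, hence closed, so a hyperplane separates \<open>- u r\<close> strictly from it.\<close>
lemma descent_direction_exists:
  fixes u :: "'i \<Rightarrow> 'a::euclidean_space" and w :: "'e \<Rightarrow> 'a"
  assumes "finite I" "finite E" "r \<in> I - positively_dependent I E u w"
  shows "\<exists>d. u r \<bullet> d < 0 \<and> (\<forall>i\<in>I. u i \<bullet> d \<le> 0) \<and> (\<forall>e\<in>E. w e \<bullet> d = 0)"
proof -
  define S where "S = u ` I \<union> w ` E \<union> (\<lambda>e. - w e) ` E"
  define K where "K = {y. \<exists>\<alpha> \<rho>. (\<forall>i\<in>I. 0 \<le> \<alpha> i) \<and> y = (\<Sum>i\<in>I. \<alpha> i *\<^sub>R u i) + (\<Sum>e\<in>E. \<rho> e *\<^sub>R w e)}"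
  have KI: "(\<Sum>i\<in>I. \<alpha> i *\<^sub>R u i) + (\<Sum>e\<in>E. \<rho> e *\<^sub>R w e) \<in> K" if "\<forall>i\<in>I. 0 \<le> \<alpha> i" for \<alpha> \<rho>
    using that unfolding K_def by blast
  have "convex_cone hull S \<subseteq> K"
  proof (rule hull_minimal)
    have "u i \<in> K" if "i \<in> I" for i
      using that KI[of "\<lambda>k. if k = i then 1 else 0" "\<lambda>_. 0"] assms(1)
      by (simp add: if_distrib[of "\<lambda>t. t *\<^sub>R _"] cong: if_cong)
    moreover have "c *\<^sub>R w e \<in> K" if "e \<in> E" for c e
      using that KI[of "\<lambda>_. 0" "\<lambda>k. if k = e then c else 0"] assms(2)
      by (simp add: if_distrib[of "\<lambda>t. t *\<^sub>R _"] cong: if_cong)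
    from this[of _ 1] this[of _ "- 1"] have "w e \<in> K" "- w e \<in> K" if "e \<in> E" for e
      using that by simp_all
    ultimately show "S \<subseteq> K" unfolding S_def by blast
    show "convex_cone K"
      unfolding convex_cone_iff
    proof (intro conjI ballI allI impI)
      show "0 \<in> K" using KI[of "\<lambda>_. 0" "\<lambda>_. 0"] by simp
    next
      fix x y assume "x \<in> K" "y \<in> K"
      then obtain \<alpha> \<rho> \<alpha>' \<rho>' where "\<forall>i\<in>I. 0 \<le> \<alpha> i" "x = (\<Sum>i\<in>I. \<alpha> i *\<^sub>R u i) + (\<Sum>e\<in>E. \<rho> e *\<^sub>R w e)"
        "\<forall>i\<in>I. 0 \<le> \<alpha>' i" "y = (\<Sum>i\<in>I. \<alpha>' i *\<^sub>R u i) + (\<Sum>e\<in>E. \<rho>' e *\<^sub>R w e)"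
        unfolding K_def by blast
      then show "x + y \<in> K"
        using KI[of "\<lambda>i. \<alpha> i + \<alpha>' i" "\<lambda>e. \<rho> e + \<rho>' e"]
        by (simp add: scaleR_add_left sum.distrib algebra_simps)
    next
      fix x and c :: real assume "x \<in> K" "0 \<le> c"
      then obtain \<alpha> \<rho> where "\<forall>i\<in>I. 0 \<le> \<alpha> i" "x = (\<Sum>i\<in>I. \<alpha> i *\<^sub>R u i) + (\<Sum>e\<in>E. \<rho> e *\<^sub>R w e)"
        unfolding K_def by blast
      then show "c *\<^sub>R x \<in> K"
        using KI[of "\<lambda>i. c * \<alpha> i" "\<lambda>e. c * \<rho> e"] \<open>0 \<le> c\<close>
        by (simp add: scaleR_add_right scaleR_sum_right)
    qed
  qed
  moreover have "- u r \<notin> K"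
  proof
    assume "- u r \<in> K"
    then obtain \<alpha> \<rho> where \<alpha>: "\<forall>i\<in>I. 0 \<le> \<alpha> i" and eq: "- u r = (\<Sum>i\<in>I. \<alpha> i *\<^sub>R u i) + (\<Sum>e\<in>E. \<rho> e *\<^sub>R w e)"
      unfolding K_def by blast
    have "(\<Sum>i\<in>I. (\<alpha> i + (if i = r then 1 else 0)) *\<^sub>R u i) = (\<Sum>i\<in>I. \<alpha> i *\<^sub>R u i) + u r"
      using assms(1,3)
      by (simp add: scaleR_add_left sum.distrib if_distrib[of "\<lambda>t. t *\<^sub>R _"] cong: if_cong)
    then have "(\<Sum>i\<in>I. (\<alpha> i + (if i = r then 1 else 0)) *\<^sub>R u i) + (\<Sum>e\<in>E. \<rho> e *\<^sub>R w e)
        = ((\<Sum>i\<in>I. \<alpha> i *\<^sub>R u i) + (\<Sum>e\<in>E. \<rho> e *\<^sub>R w e)) + u r"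
      by (simp only: ac_simps)
    then have "(\<Sum>i\<in>I. (\<alpha> i + (if i = r then 1 else 0)) *\<^sub>R u i) + (\<Sum>e\<in>E. \<rho> e *\<^sub>R w e) = 0"
      by (simp flip: eq)
    moreover have "0 < \<alpha> r + (if r = r then 1 else 0)" using \<alpha> assms(3) by (simp add: add_nonneg_pos)
    moreover have "\<forall>i\<in>I. 0 \<le> \<alpha> i + (if i = r then 1 else 0)" using \<alpha> by simp
    ultimately have "r \<in> positively_dependent I E u w"
      using assms(3) unfolding positively_dependent_def mem_Collect_eq
      by (intro conjI exI[of _ "\<lambda>i. \<alpha> i + (if i = r then 1 else 0)"] exI[of _ \<rho>]) auto
    with assms(3) show False by simp
  qed
  ultimately have "- u r \<notin> convex_cone hull S" by blast
  moreover have "closed (convex_cone hull S)"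
    by (rule polyhedron_imp_closed[OF polyhedron_convex_cone_hull]) (simp add: S_def assms)
  ultimately obtain d b where d: "d \<bullet> (- u r) < b" "\<And>x. x \<in> convex_cone hull S \<Longrightarrow> b < d \<bullet> x"
    using separating_hyperplane_closed_point[OF convex_convex_cone_hull] by blast
  have "b < 0" using d(2)[OF convex_cone_hull_contains_0] by simp
  have nonneg: "0 \<le> d \<bullet> x" if "x \<in> S" for x
  proof (rule ccontr)
    assume neg: "\<not> 0 \<le> d \<bullet> x"
    \<comment> \<open>A negative slope could be scaled down to exactly the separation level \<open>b\<close>.\<close>
    have "(b / (d \<bullet> x)) *\<^sub>R x \<in> convex_cone hull S"
      using that neg \<open>b < 0\<close> by (intro convex_cone_hull_mul hull_inc) (auto simp: divide_nonpos_neg)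
    from d(2)[OF this] neg show False by simp
  qed
  have "w e \<bullet> d = 0" if "e \<in> E" for e
    using nonneg[of "w e"] nonneg[of "- w e"] that by (auto simp: S_def inner_commute)
  moreover have "0 \<le> u i \<bullet> d" if "i \<in> I" for i
    using nonneg[of "u i"] that by (auto simp: S_def inner_commute)
  moreover have "u r \<bullet> d > 0" using d(1) \<open>b < 0\<close> by (simp add: inner_commute)
  ultimately show ?thesis by (intro exI[of _ "- d"]) auto
qed

text \<open>Sum the directions of the preceding lemma over all \<open>r\<close>. The indices in a positive vanishing
combination cannot decrease along the sum, since their weighted slopes add up to zero.\<close>
lemma strict_descent_direction_exists:
  fixes u :: "'i \<Rightarrow> 'a::euclidean_space" and w :: "'e \<Rightarrow> 'a"
  assumes "finite I" "finite E"
  obtains d where "\<forall>i\<in>I - positively_dependent I E u w. u i \<bullet> d < 0"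
    "\<forall>i\<in>positively_dependent I E u w. u i \<bullet> d = 0" "\<forall>e\<in>E. w e \<bullet> d = 0"
proof -
  let ?J = "positively_dependent I E u w"
  have "?J \<subseteq> I" by (auto simp: positively_dependent_def)
  have "finite ?J" using \<open>?J \<subseteq> I\<close> assms(1) by (rule finite_subset)
  have "\<forall>r\<in>I - ?J. \<exists>d. u r \<bullet> d < 0 \<and> (\<forall>i\<in>I. u i \<bullet> d \<le> 0) \<and> (\<forall>e\<in>E. w e \<bullet> d = 0)"
    using descent_direction_exists[OF assms] by blast
  then obtain D where D: "\<forall>r\<in>I - ?J. u r \<bullet> D r < 0 \<and> (\<forall>i\<in>I. u i \<bullet> D r \<le> 0) \<and> (\<forall>e\<in>E. w e \<bullet> D r = 0)"
    by (rule bchoice[THEN exE])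
  define d where "d = (\<Sum>r\<in>I - ?J. D r)"
  have "u i \<bullet> d < 0" if "i \<in> I - ?J" for i
  proof -
    have "(\<Sum>r\<in>I - ?J. u i \<bullet> D r) < (\<Sum>r\<in>I - ?J. 0)"
      using D that assms(1) by (intro sum_strict_mono_ex1) auto
    then show ?thesis by (simp add: d_def inner_sum_right)
  qed
  moreover have le: "u i \<bullet> d \<le> 0" if "i \<in> I" for i
    unfolding d_def inner_sum_right using D that by (intro sum_nonpos) auto
  moreover have w: "w e \<bullet> d = 0" if "e \<in> E" for e
    unfolding d_def inner_sum_right using D that by (intro sum.neutral) auto
  moreover have "u i \<bullet> d = 0" if "i \<in> ?J" for i
  proof -
    obtain \<alpha> \<rho> where \<alpha>: "\<forall>i\<in>?J. 0 < \<alpha> i" and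
      zero: "(\<Sum>i\<in>?J. \<alpha> i *\<^sub>R u i) + (\<Sum>e\<in>E. \<rho> e *\<^sub>R w e) = 0"
      by (rule positive_combination_exists[OF assms(1)])
    have "(\<Sum>i\<in>?J. \<alpha> i * - (u i \<bullet> d)) = 0"
      using arg_cong[OF zero, of "\<lambda>y. y \<bullet> d"] w
      by (simp add: inner_add_left inner_sum_left sum_negf)
    moreover have "\<forall>i\<in>?J. 0 \<le> \<alpha> i * - (u i \<bullet> d)"
      using \<alpha> le \<open>?J \<subseteq> I\<close> by (intro ballI mult_nonneg_nonneg) (auto intro: less_imp_le)
    ultimately have "\<alpha> i * - (u i \<bullet> d) = 0"
      using that sum_nonneg_eq_0_iff[OF \<open>finite ?J\<close>, of "\<lambda>i. \<alpha> i * - (u i \<bullet> d)"] by blast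
    then show ?thesis using \<alpha> that by auto
  qed
  ultimately show ?thesis using that by blast
qed

section \<open>An error bound under constant rank\<close>

text \<open>Active inequalities \<open>g i \<le> 0\<close> and equalities \<open>F e = 0\<close> at \<open>a\<close> under the constant rank of the subspace
component condition, which controls the rank of the gradients of the equalities and of those
inequalities that are forced to behave like equalities.\<close>
locale constant_rank_constraints =
  fixes I :: "'i set" and E :: "'e set"
    and g :: "'i \<Rightarrow> 'a::euclidean_space \<Rightarrow> real" and g' :: "'i \<Rightarrow> 'a \<Rightarrow> 'a"
    and F :: "'e \<Rightarrow> 'a \<Rightarrow> real" and F' :: "'e \<Rightarrow> 'a \<Rightarrow> 'a"
    and a :: 'a and J :: "'i set"
  assumes J_def: "J = positively_dependent I E (\<lambda>i. g' i a) (\<lambda>e. F' e a)"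
    and finite_I: "finite I" and finite_E: "finite E"
    and C1_g: "\<And>i. i \<in> I \<Longrightarrow> C1_with_gradient (g i) (g' i)"
    and C1_F: "\<And>e. e \<in> E \<Longrightarrow> C1_with_gradient (F e) (F' e)"
    and active: "\<And>i. i \<in> I \<Longrightarrow> g i a = 0" "\<And>e. e \<in> E \<Longrightarrow> F e a = 0"
    and rank: "\<forall>\<^sub>F x in nhds a. dim ((\<lambda>i. g' i x) ` J \<union> (\<lambda>e. F' e x) ` E) =
                 dim ((\<lambda>i. g' i a) ` J \<union> (\<lambda>e. F' e a) ` E)"
begin

definition violation :: "'a \<Rightarrow> real" where
  "violation x = (\<Sum>i\<in>I. max (g i x) 0) + (\<Sum>e\<in>E. \<bar>F e x\<bar>)"

text \<open>The violation when the inequalities in \<open>J\<close> are read as equalities.\<close>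
definition residual :: "'a \<Rightarrow> real" where
  "residual x = (\<Sum>i\<in>J. \<bar>g i x\<bar>) + (\<Sum>e\<in>E. \<bar>F e x\<bar>)"

lemma J_subset: "J \<subseteq> I"
  by (auto simp: J_def positively_dependent_def)

lemma finite_J: "finite J"
  using J_subset finite_I by (rule finite_subset)

lemma violation_nonneg: "0 \<le> violation x"
  by (simp add: violation_def sum_nonneg)

lemma violation_active [simp]: "violation a = 0"
  by (simp add: violation_def active)

lemma constraint_le_violation:
  "i \<in> I \<Longrightarrow> max (g i x) 0 \<le> violation x"
  "e \<in> E \<Longrightarrow> \<bar>F e x\<bar> \<le> violation x"
proof -
  have nonneg: "0 \<le> (\<Sum>i\<in>I. max (g i x) 0)" "0 \<le> (\<Sum>e\<in>E. \<bar>F e x\<bar>)"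
    by (simp_all add: sum_nonneg)
  show "max (g i x) 0 \<le> violation x" if "i \<in> I"
  proof -
    have "max (g i x) 0 \<le> (\<Sum>i\<in>I. max (g i x) 0)"
      using that finite_I by (intro member_le_sum) auto
    with nonneg show ?thesis unfolding violation_def by linarith
  qed
  show "\<bar>F e x\<bar> \<le> violation x" if "e \<in> E"
  proof -
    have "\<bar>F e x\<bar> \<le> (\<Sum>e\<in>E. \<bar>F e x\<bar>)"
      using that finite_E by (intro member_le_sum) auto
    with nonneg show ?thesis unfolding violation_def by linarith
  qed
qed

lemma isCont_violation: "isCont violation x"
  unfolding violation_def
  by (intro continuous_intros C1_isCont) (auto intro: C1_g C1_F)

lemma sum_Plus_case_sum:
  "(\<Sum>q\<in>J <+> E. f q) = (\<Sum>i\<in>J. f (Inl i)) + (\<Sum>e\<in>E. f (Inr e))" for f :: "'i + 'e \<Rightarrow> 'z::comm_monoid_add"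
  using finite_J finite_E by (simp add: sum.Plus)

lemma ball_Plus: "(\<forall>q\<in>J <+> E. P q) \<longleftrightarrow> (\<forall>i\<in>J. P (Inl i)) \<and> (\<forall>e\<in>E. P (Inr e))"
  by (simp add: Plus_def ball_Un)

lemma equality_family:
  "finite (J <+> E)"
  "\<And>q. q \<in> J <+> E \<Longrightarrow> C1_with_gradient (case_sum g F q) (case_sum g' F' q)"
  "\<And>q. q \<in> J <+> E \<Longrightarrow> case_sum g F q a = 0"
  "\<forall>\<^sub>F x in nhds a. dim ((\<lambda>q. case_sum g' F' q x) ` (J <+> E)) =
     dim ((\<lambda>q. case_sum g' F' q a) ` (J <+> E))"
proof -
  have "(\<lambda>q. case_sum g' F' q x) ` (J <+> E) = (\<lambda>i. g' i x) ` J \<union> (\<lambda>e. F' e x) ` E" for x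
    by (simp add: Plus_def image_Un image_image)
  with rank show "\<forall>\<^sub>F x in nhds a. dim ((\<lambda>q. case_sum g' F' q x) ` (J <+> E)) =
     dim ((\<lambda>q. case_sum g' F' q a) ` (J <+> E))" by simp
  show "C1_with_gradient (case_sum g F q) (case_sum g' F' q)" if "q \<in> J <+> E" for q
    using that J_subset C1_g C1_F by (auto simp: Plus_def)
  show "case_sum g F q a = 0" if "q \<in> J <+> E" for q
    using that J_subset active by (auto simp: Plus_def)
qed (simp add: finite_J finite_E)

text \<open>A vanishing combination of the gradients at \<open>a\<close> with weights \<open>\<alpha> > 0\<close> on \<open>J\<close> yields a combination
of the constraints that is at most half the least weight \<open>m\<close> times the residual. Since
\<open>\<bar>g\<bar> = 2 max g 0 - g\<close>, the \<open>\<alpha>\<close>-weighted residual of \<open>J\<close> is bounded by the violation plus that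
small quantity, which is absorbed into the left-hand side.\<close>
lemma residual_bound:
  "\<exists>C>0. \<forall>\<^sub>F x in nhds a. residual x \<le> C * violation x"
proof -
  obtain \<alpha> \<rho> where \<alpha>: "\<forall>i\<in>J. 0 < \<alpha> i"
    and zero: "(\<Sum>i\<in>J. \<alpha> i *\<^sub>R g' i a) + (\<Sum>e\<in>E. \<rho> e *\<^sub>R F' e a) = 0"
    unfolding J_def by (rule positive_combination_exists[OF finite_I])
  define m where "m = Min (insert 1 (\<alpha> ` J))"
  have m: "m \<le> \<alpha> i" if "i \<in> J" for i
    using that finite_J by (auto simp: m_def)
  have "m > 0" using \<alpha> finite_J by (auto simp: m_def)
  define L where "L = 2 * (\<Sum>i\<in>J. \<alpha> i) + (\<Sum>e\<in>E. \<bar>\<rho> e\<bar>)"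
  have "L \<ge> 0" unfolding L_def using \<alpha> by (intro add_nonneg_nonneg mult_nonneg_nonneg sum_nonneg) (auto intro: less_imp_le)
  have "(\<Sum>q\<in>J <+> E. case_sum \<alpha> \<rho> q *\<^sub>R case_sum g' F' q a) = 0"
    using zero by (simp add: sum_Plus_case_sum)
  from constant_rank_negligible_combination[of "J <+> E" "case_sum g F" "case_sum g' F'" a, OF equality_family this, of "m / 2"]
  have "\<forall>\<^sub>F x in nhds a. \<bar>(\<Sum>i\<in>J. \<alpha> i * g i x) + (\<Sum>e\<in>E. \<rho> e * F e x)\<bar> \<le> m / 2 * residual x"
    using \<open>m > 0\<close> by (simp add: sum_Plus_case_sum residual_def)
  then have "\<forall>\<^sub>F x in nhds a. residual x \<le> (2 * L / m + 2) * violation x"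
  proof eventually_elim
    case (elim x)
    let ?v = "violation x"
    have "max (g i x) 0 \<le> ?v" if "i \<in> J" for i
      using that J_subset by (intro constraint_le_violation) auto
    then have \<alpha>_pos: "(\<Sum>i\<in>J. \<alpha> i * max (g i x) 0) \<le> (\<Sum>i\<in>J. \<alpha> i) * ?v"
      unfolding sum_distrib_right using \<alpha> by (intro sum_mono mult_left_mono) (auto intro: less_imp_le)
    have "(\<Sum>e\<in>E. \<bar>\<rho> e\<bar> * \<bar>F e x\<bar>) \<le> (\<Sum>e\<in>E. \<bar>\<rho> e\<bar>) * ?v"
      unfolding sum_distrib_right by (intro sum_mono mult_left_mono constraint_le_violation) auto
    then have \<rho>: "\<bar>\<Sum>e\<in>E. \<rho> e * F e x\<bar> \<le> (\<Sum>e\<in>E. \<bar>\<rho> e\<bar>) * ?v"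
      using sum_abs[of "\<lambda>e. \<rho> e * F e x" E] by (simp add: abs_mult)
    have "m * (\<Sum>i\<in>J. \<bar>g i x\<bar>) \<le> (\<Sum>i\<in>J. \<alpha> i * \<bar>g i x\<bar>)"
      unfolding sum_distrib_left using m by (intro sum_mono mult_right_mono) auto
    also have "\<dots> = (\<Sum>i\<in>J. 2 * (\<alpha> i * max (g i x) 0) - \<alpha> i * g i x)"
      by (intro sum.cong refl) (auto simp: max_def algebra_simps)
    also have "\<dots> = 2 * (\<Sum>i\<in>J. \<alpha> i * max (g i x) 0) - (\<Sum>i\<in>J. \<alpha> i * g i x)"
      by (simp add: sum_subtractf sum_distrib_left)
    also have "\<dots> \<le> 2 * ((\<Sum>i\<in>J. \<alpha> i) * ?v) + (m / 2 * residual x + (\<Sum>e\<in>E. \<bar>\<rho> e\<bar>) * ?v)"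
      using elim \<alpha>_pos \<rho> by linarith
    also have "\<dots> = L * ?v + m / 2 * residual x" by (simp add: L_def algebra_simps)
    finally have "m * (\<Sum>i\<in>J. \<bar>g i x\<bar>) \<le> L * ?v + m / 2 * residual x" .
    moreover have "m * (\<Sum>e\<in>E. \<bar>F e x\<bar>) \<le> m * ?v"
      using \<open>m > 0\<close> by (intro mult_left_mono) (auto simp: violation_def sum_nonneg)
    ultimately have "m / 2 * residual x \<le> (L + m) * ?v"
      by (simp add: residual_def algebra_simps)
    then show ?case using \<open>m > 0\<close> by (simp add: field_simps)
  qed
  moreover have "2 * L / m + 2 > 0" using \<open>L \<ge> 0\<close> \<open>m > 0\<close> by (simp add: add_nonneg_pos)
  ultimately show ?thesis by blast
qed

text \<open>From \<open>x\<close> with violation \<open>v\<close>, step to \<open>s x = x + T v d\<close>, where \<open>d\<close> is a direction of strict descent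
for the inequalities outside \<open>J\<close> that is stationary for all others. The residual at \<open>s x\<close> is still
of the order of \<open>v\<close>, so a common zero \<open>x'\<close> of the constant rank family lies within a multiple of
\<open>v\<close> of \<open>s x\<close>. For large \<open>T\<close> the gain \<open>T v \<sigma>\<close> along \<open>d\<close> outweighs both the initial value, at
most \<open>v\<close>, and the change caused by this correction.\<close>
theorem error_bound:
  "\<exists>C>0. \<forall>\<eta>>0. \<forall>\<^sub>F x in nhds a. \<exists>x'\<in>ball a \<eta>.
     (\<forall>i\<in>I. g i x' \<le> 0) \<and> (\<forall>e\<in>E. F e x' = 0) \<and> dist x x' \<le> C * violation x"
proof -
  obtain C where "C > 0" and C: "\<forall>\<^sub>F x in nhds a. residual x \<le> C * violation x"
    using residual_bound by blast
  obtain K where "K > 0" and K: "\<forall>\<eta>>0. \<forall>\<^sub>F x in nhds a. \<exists>x'\<in>ball a \<eta>.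
      (\<forall>q\<in>J <+> E. case_sum g F q x' = 0) \<and> dist x x' \<le> K * (\<Sum>q\<in>J <+> E. \<bar>case_sum g F q x\<bar>)"
    using constant_rank_nearby_zero[of "J <+> E" "case_sum g F" "case_sum g' F'" a, OF equality_family]
    by auto
  have near: "\<forall>\<^sub>F x in nhds a. \<exists>x'\<in>ball a \<eta>. (\<forall>i\<in>J. g i x' = 0) \<and> (\<forall>e\<in>E. F e x' = 0) \<and>
      dist x x' \<le> K * residual x" if "\<eta> > 0" for \<eta>
    using K[rule_format, OF that]
    by (simp add: sum_Plus_case_sum residual_def ball_Plus)
  obtain d where d: "\<forall>i\<in>I - J. g' i a \<bullet> d < 0" "\<forall>i\<in>J. g' i a \<bullet> d = 0" "\<forall>e\<in>E. F' e a \<bullet> d = 0"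
    unfolding J_def by (rule strict_descent_direction_exists[OF finite_I finite_E])
  define \<sigma> where "\<sigma> = Min (insert 1 ((\<lambda>i. - (g' i a \<bullet> d)) ` (I - J)))"
  have "\<sigma> > 0" using d(1) finite_I by (auto simp: \<sigma>_def)
  have \<sigma>: "g' i a \<bullet> d \<le> - \<sigma>" if "i \<in> I - J" for i
  proof -
    have "\<sigma> \<le> - (g' i a \<bullet> d)" unfolding \<sigma>_def using that finite_I by (intro Min_le) auto
    then show ?thesis by simp
  qed
  define N where "N = real (card J + card E)"
  define U where "U = (\<Sum>i\<in>I. norm (g' i a)) + 1"
  have "U > 0" by (simp add: U_def add_nonneg_pos sum_nonneg)
  have U: "norm (g' i a) + 1 \<le> U" if "i \<in> I" for i
    using member_le_sum[OF that, of "\<lambda>i. norm (g' i a)"] finite_I by (simp add: U_def)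
  \<comment> \<open>\<open>\<epsilon> * T * P\<close> will collect all error terms that grow with \<open>T\<close>; hence \<open>\<epsilon>\<close> is chosen before \<open>T\<close>,
    small enough that these errors use up at most half of the gain \<open>\<sigma> * T\<close>.\<close>
  define P where "P = (U * K * N + 1) * norm d"
  have "P \<ge> 0" unfolding P_def N_def using \<open>U > 0\<close> \<open>K > 0\<close> by simp
  define \<epsilon> where "\<epsilon> = min 1 (\<sigma> / (2 * (P + 1)))"
  have "\<epsilon> > 0" "\<epsilon> \<le> 1" using \<open>\<sigma> > 0\<close> \<open>P \<ge> 0\<close> by (auto simp: \<epsilon>_def)
  have \<epsilon>P: "\<epsilon> * P \<le> \<sigma> / 2"
  proof -
    have "\<epsilon> * P \<le> \<sigma> / (2 * (P + 1)) * (P + 1)"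
      using \<open>P \<ge> 0\<close> \<open>\<sigma> > 0\<close> by (intro mult_mono) (auto simp: \<epsilon>_def)
    also have "\<dots> = \<sigma> / 2"
    proof -
      have "P + 1 \<noteq> 0" using \<open>P \<ge> 0\<close> by linarith
      from nonzero_mult_divide_mult_cancel_right[OF this, of \<sigma> 2]
      show ?thesis by (simp only: times_divide_eq_left)
    qed
    finally show ?thesis .
  qed
  \<comment> \<open>The other half of the gain pays for the terms that do not depend on \<open>T\<close>.\<close>
  define T where "T = 2 * (1 + U * K * C) / \<sigma>"
  have "T > 0" unfolding T_def using \<open>U > 0\<close> \<open>K > 0\<close> \<open>C > 0\<close> \<open>\<sigma> > 0\<close>
    by (intro divide_pos_pos mult_pos_pos add_pos_pos) auto
  \<comment> \<open>\<open>R * violation x\<close> bounds the length of the correction from \<open>s x\<close> onto the zero set.\<close>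
  define R where "R = K * (C + N * \<epsilon> * T * norm d)"
  have "R > 0" unfolding R_def N_def using \<open>K > 0\<close> \<open>C > 0\<close> \<open>\<epsilon> > 0\<close> \<open>T > 0\<close>
    by (intro mult_pos_pos add_pos_nonneg) auto
  have budget: "1 - \<sigma> * T + U * R + \<epsilon> * (T * norm d) \<le> 0"
  proof -
    have "U * R + \<epsilon> * (T * norm d) = U * K * C + T * (\<epsilon> * P)"
      by (simp add: R_def P_def algebra_simps)
    also have "\<dots> \<le> U * K * C + T * (\<sigma> / 2)"
      using \<epsilon>P \<open>T > 0\<close> by (intro add_left_mono mult_left_mono) auto
    finally show ?thesis using \<open>\<sigma> > 0\<close> by (simp add: T_def field_simps)
  qed
  obtain \<delta>1 where "\<delta>1 > 0" and \<delta>1: "\<And>i x y. \<lbrakk>i \<in> I; x \<in> ball a \<delta>1; y \<in> ball a \<delta>1\<rbrakk> \<Longrightarrow>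
       \<bar>g i x - g i y - g' i a \<bullet> (x - y)\<bar> \<le> \<epsilon> * norm (x - y)"
    by (rule C1_strict_derivative_finite[OF finite_I C1_g \<open>\<epsilon> > 0\<close>, where a = a]) auto
  obtain \<delta>2 where "\<delta>2 > 0" and \<delta>2: "\<And>e x y. \<lbrakk>e \<in> E; x \<in> ball a \<delta>2; y \<in> ball a \<delta>2\<rbrakk> \<Longrightarrow>
       \<bar>F e x - F e y - F' e a \<bullet> (x - y)\<bar> \<le> \<epsilon> * norm (x - y)"
    by (rule C1_strict_derivative_finite[OF finite_E C1_F \<open>\<epsilon> > 0\<close>, where a = a]) auto
  define \<delta> where "\<delta> = min \<delta>1 \<delta>2"
  have "\<delta> > 0" using \<open>\<delta>1 > 0\<close> \<open>\<delta>2 > 0\<close> by (simp add: \<delta>_def)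
  define s where "s x = x + (T * violation x) *\<^sub>R d" for x
  have "isCont s a" unfolding s_def by (intro continuous_intros isCont_violation)
  moreover have "s a = a" by (simp add: s_def)
  ultimately have s_lim: "(s \<longlongrightarrow> a) (nhds a)"
    unfolding isCont_def using tendsto_at_iff_tendsto_nhds by metis
  have "\<forall>\<^sub>F x in nhds a. \<exists>x'\<in>ball a \<eta>.
     (\<forall>i\<in>I. g i x' \<le> 0) \<and> (\<forall>e\<in>E. F e x' = 0) \<and> dist x x' \<le> (T * norm d + R) * violation x"
    if "\<eta> > 0" for \<eta>
  proof -
    have "min \<eta> \<delta> > 0" using that \<open>\<delta> > 0\<close> by simp
    from eventually_compose_filterlim[OF near[OF this] s_lim]
    have "\<forall>\<^sub>F x in nhds a. \<exists>x'\<in>ball a (min \<eta> \<delta>). (\<forall>i\<in>J. g i x' = 0) \<and> (\<forall>e\<in>E. F e x' = 0) \<and>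
      dist (s x) x' \<le> K * residual (s x)" .
    moreover have "\<forall>\<^sub>F x in nhds a. dist x a < \<delta>"
      using \<open>\<delta> > 0\<close> by (auto simp: eventually_nhds_metric)
    moreover have "\<forall>\<^sub>F x in nhds a. dist (s x) a < \<delta>"
      using s_lim \<open>\<delta> > 0\<close> by (rule tendstoD)
    ultimately show ?thesis using C
    proof eventually_elim
      case (elim x)
      let ?v = "violation x"
      obtain x' where x': "x' \<in> ball a (min \<eta> \<delta>)" "\<forall>i\<in>J. g i x' = 0" "\<forall>e\<in>E. F e x' = 0"
        and dist: "dist (s x) x' \<le> K * residual (s x)"
        using elim(1) by blast
      have ball: "x \<in> ball a \<delta>1" "x \<in> ball a \<delta>2" "s x \<in> ball a \<delta>1" "s x \<in> ball a \<delta>2" "x' \<in> ball a \<delta>1"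
        using elim(2,3) x'(1) by (simp_all add: \<delta>_def dist_commute)
      have sx: "s x - x = (T * ?v) *\<^sub>R d" by (simp add: s_def)
      have norm_sx: "norm (s x - x) = T * ?v * norm d"
        using \<open>T > 0\<close> violation_nonneg by (simp add: sx abs_mult)
      have g_step: "\<bar>g i (s x)\<bar> \<le> \<bar>g i x\<bar> + \<epsilon> * (T * ?v * norm d)" if "i \<in> J" for i
      proof -
        have "i \<in> I" using that J_subset by blast
        from \<delta>1[OF this ball(3,1)] d(2) that show ?thesis
          unfolding norm_sx by (simp add: sx)
      qed
      have F_step: "\<bar>F e (s x)\<bar> \<le> \<bar>F e x\<bar> + \<epsilon> * (T * ?v * norm d)" if "e \<in> E" for e
        using \<delta>2[OF that ball(4,2)] d(3) that
        unfolding norm_sx by (simp add: sx)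
      have "residual (s x) \<le> (\<Sum>i\<in>J. \<bar>g i x\<bar> + \<epsilon> * (T * ?v * norm d)) + (\<Sum>e\<in>E. \<bar>F e x\<bar> + \<epsilon> * (T * ?v * norm d))"
        unfolding residual_def by (intro add_mono sum_mono g_step F_step)
      also have "\<dots> = residual x + N * (\<epsilon> * (T * ?v * norm d))"
        by (simp add: residual_def N_def sum.distrib algebra_simps)
      also have "\<dots> \<le> C * ?v + N * (\<epsilon> * (T * ?v * norm d))" using elim(4) by simp
      finally have "K * residual (s x) \<le> K * (C * ?v + N * (\<epsilon> * (T * ?v * norm d)))"
        using \<open>K > 0\<close> by (intro mult_left_mono) auto
      also have "\<dots> = R * ?v" by (simp add: R_def algebra_simps)
      finally have corr: "norm (x' - s x) \<le> R * ?v" using dist by (simp add: dist_norm norm_minus_commute)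
      have step: "norm (x' - x) \<le> (T * norm d + R) * ?v"
        using norm_triangle_ineq[of "x' - s x" "s x - x"] corr unfolding norm_sx by (simp add: algebra_simps)
      have "g i x' \<le> 0" if "i \<in> I - J" for i
      proof -
        have i: "i \<in> I" using that by simp
        have "g' i a \<bullet> (x' - x) = T * ?v * (g' i a \<bullet> d) + g' i a \<bullet> (x' - s x)"
          by (simp add: s_def inner_diff_right inner_add_right)
        moreover have "T * ?v * (g' i a \<bullet> d) \<le> T * ?v * (- \<sigma>)"
          using \<sigma>[OF that] \<open>T > 0\<close> violation_nonneg by (intro mult_left_mono) auto
        moreover have "g' i a \<bullet> (x' - s x) \<le> norm (g' i a) * (R * ?v)"
          using norm_cauchy_schwarz[of "g' i a" "x' - s x"] corr
          by (meson mult_left_mono norm_ge_zero order_trans)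
        moreover have "g i x \<le> ?v" using constraint_le_violation(1)[OF i, of x] by simp
        moreover have "\<epsilon> * norm (x' - x) \<le> \<epsilon> * ((T * norm d + R) * ?v)"
          using step \<open>\<epsilon> > 0\<close> by (intro mult_left_mono) auto
        moreover have "\<epsilon> * (R * ?v) \<le> 1 * (R * ?v)"
          using \<open>\<epsilon> \<le> 1\<close> \<open>R > 0\<close> violation_nonneg by (intro mult_right_mono) auto
        moreover have "(norm (g' i a) + 1) * (R * ?v) \<le> U * (R * ?v)"
          using U[OF i] \<open>R > 0\<close> violation_nonneg by (intro mult_right_mono) auto
        ultimately have "g i x' \<le> (1 - \<sigma> * T + U * R + \<epsilon> * (T * norm d)) * ?v"
          using \<delta>1[OF i ball(5,1)] by (simp add: algebra_simps)
        also have "\<dots> \<le> 0" using budget violation_nonneg by (rule mult_nonpos_nonneg)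
        finally show ?thesis .
      qed
      with x'(2) have "\<forall>i\<in>I. g i x' \<le> 0" by force
      moreover have "x' \<in> ball a \<eta>" using x'(1) by simp
      ultimately show ?case using x'(3) step by (auto simp: dist_norm norm_minus_commute)
    qed
  qed
  moreover have "T * norm d + R > 0" using \<open>T > 0\<close> \<open>R > 0\<close> by (simp add: add_nonneg_pos)
  ultimately show ?thesis by blast
qed

end

section \<open>Exact penalization\<close>

lemma twice_continuously_differentiable_imp_C1:
  assumes "twice_continuously_differentiable \<phi>"
  shows "C1_with_gradient \<phi> (gradient \<phi>)"
proof -
  obtain f' f'' where f': "\<And>x. GDERIV \<phi> x :> f' x"
    and f'': "\<And>x. (f' has_derivative blinfun_apply (f'' x)) (at x)"
    using assms unfolding twice_continuously_differentiable_def by blast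
  have "gradient \<phi> = f'" by (intro ext gradient_eqI f')
  moreover have "continuous_on UNIV f'"
    by (intro continuous_at_imp_continuous_on ballI has_derivative_continuous[OF f''])
  ultimately show ?thesis using f' by (simp add: C1_with_gradient_def)
qed

text \<open>The three families of equality constraints of a branch are merged into one family indexed by a sum
type.\<close>
lemma I_g_minus_positively_dependent:
  assumes "finite A" "finite B"
    and A: "A = I_G l G H x \<union> \<beta>1" and B: "B = I_H l G H x \<union> \<beta>2"
  shows "I_g_minus m p l g h G H x \<beta>1 \<beta>2 =
    positively_dependent (I_g m g x) ({1..p} <+> (A <+> B)) (\<lambda>i. gradient (g i) x)
      (\<lambda>e. gradient (case_sum h (case_sum G H) e) x)" (is "_ = positively_dependent ?I ?E ?u ?w")
proof (rule set_eqI)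
  fix r
  have sum_E: "(\<Sum>e\<in>?E. \<rho> e *\<^sub>R ?w e) = (\<Sum>j\<in>{1..p}. \<rho> (Inl j) *\<^sub>R gradient (h j) x) +
      ((\<Sum>k\<in>A. \<rho> (Inr (Inl k)) *\<^sub>R gradient (G k) x) + (\<Sum>k\<in>B. \<rho> (Inr (Inr k)) *\<^sub>R gradient (H k) x))"
    for \<rho> using assms(1,2) by (simp add: sum.Plus)
  have "finite ?I" by (simp add: I_g_def)
  have "(\<exists>\<alpha> \<rho>. (\<forall>i\<in>?I - {r}. 0 \<le> \<alpha> i) \<and> - ?u r = (\<Sum>i\<in>?I - {r}. \<alpha> i *\<^sub>R ?u i) + (\<Sum>e\<in>?E. \<rho> e *\<^sub>R ?w e))
    \<longleftrightarrow> (\<exists>\<alpha> \<rho> \<mu> \<nu>. (\<forall>i\<in>?I - {r}. 0 \<le> \<alpha> i) \<and> - ?u r = (\<Sum>i\<in>?I - {r}. \<alpha> i *\<^sub>R ?u i) +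
      (\<Sum>j\<in>{1..p}. \<rho> j *\<^sub>R gradient (h j) x) + (\<Sum>k\<in>A. \<mu> k *\<^sub>R gradient (G k) x) +
      (\<Sum>k\<in>B. \<nu> k *\<^sub>R gradient (H k) x))" (is "(\<exists>\<alpha> \<rho>. ?P \<alpha> \<rho>) \<longleftrightarrow> (\<exists>\<alpha> \<rho> \<mu> \<nu>. ?Q \<alpha> \<rho> \<mu> \<nu>)")
  proof
    assume "\<exists>\<alpha> \<rho>. ?P \<alpha> \<rho>"
    then obtain \<alpha> \<rho> where "?P \<alpha> \<rho>" by (elim exE)
    from this[unfolded sum_E] have "?Q \<alpha> (\<lambda>j. \<rho> (Inl j)) (\<lambda>k. \<rho> (Inr (Inl k))) (\<lambda>k. \<rho> (Inr (Inr k)))"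
      unfolding add.assoc .
    then show "\<exists>\<alpha> \<rho> \<mu> \<nu>. ?Q \<alpha> \<rho> \<mu> \<nu>" by (intro exI)
  next
    assume "\<exists>\<alpha> \<rho> \<mu> \<nu>. ?Q \<alpha> \<rho> \<mu> \<nu>"
    then obtain \<alpha> \<rho> \<mu> \<nu> where "?Q \<alpha> \<rho> \<mu> \<nu>" by (elim exE)
    from this[unfolded add.assoc] have "?P \<alpha> (case_sum \<rho> (case_sum \<mu> \<nu>))"
      unfolding sum_E sum.case .
    then show "\<exists>\<alpha> \<rho>. ?P \<alpha> \<rho>" by (intro exI)
  qed
  then show "r \<in> I_g_minus m p l g h G H x \<beta>1 \<beta>2 \<longleftrightarrow> r \<in> positively_dependent ?I ?E ?u ?w"
    unfolding positively_dependent_iff[OF \<open>finite ?I\<close>] I_g_minus_def A B mem_Collect_eq by (simp only:)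
qed

text \<open>Local optimality at the feasible point \<open>x'\<close> supplied by the error bound gives
\<open>f xb \<le> f x' \<le> f x + L * dist x x'\<close>, and the distance is at most a multiple of the violation, which
is itself at most \<open>n\<close> times its Euclidean norm. The inactive inequalities hold at \<open>x'\<close> because it is
close to \<open>xb\<close>.\<close>
lemma branch_exact_penalty:
  fixes f :: "real^'n \<Rightarrow> real" and g h G H :: "nat \<Rightarrow> real^'n \<Rightarrow> real"
  assumes f: "twice_continuously_differentiable f"
    and g: "\<forall>i\<in>{1..m}. twice_continuously_differentiable (g i)"
    and h: "\<forall>j\<in>{1..p}. twice_continuously_differentiable (h j)"
    and G: "\<forall>k\<in>{1..l}. twice_continuously_differentiable (G k)"
    and H: "\<forall>k\<in>{1..l}. twice_continuously_differentiable (H k)"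
    and opt: "locally_optimal f (mpsc_feasible m p l g h G H) xb"
    and pcrsc: "mpsc_pcrsc m p l g h G H xb"
    and \<beta>: "(\<beta>1, \<beta>2) \<in> bipartitions (I_GH l G H xb)"
    and A: "A = I_G l G H xb \<union> \<beta>1" and B: "B = I_H l G H xb \<union> \<beta>2"
  shows "\<exists>\<kappa>. \<forall>\<^sub>F x in nhds xb. f xb \<le> f x + \<kappa> * sqrt ((\<Sum>i=1..m. (max (g i x) 0)\<^sup>2) +
           (\<Sum>j=1..p. (h j x)\<^sup>2) + ((\<Sum>k\<in>A. (G k x)\<^sup>2) + (\<Sum>k\<in>B. (H k x)\<^sup>2)))"
proof -
  have feas: "xb \<in> mpsc_feasible m p l g h G H"
    using opt by (simp add: locally_optimal_def)
  have AB: "A \<union> B = {1..l}"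
    using feas \<beta> by (auto simp: A B mpsc_feasible_def bipartitions_def I_G_def I_H_def I_GH_def)
  have "finite (A \<union> B)" unfolding AB by simp
  then have fin: "finite A" "finite B" by simp_all
  define I where "I = I_g m g xb"
  define E where "E = {1..p} <+> (A <+> B)"
  define F where "F = case_sum h (case_sum G H)"
  define J where "J = positively_dependent I E (\<lambda>i. gradient (g i) xb) (\<lambda>e. gradient (F e) xb)"
  have J: "I_g_minus m p l g h G H xb \<beta>1 \<beta>2 = J"
    unfolding J_def I_def E_def F_def by (rule I_g_minus_positively_dependent[OF fin A B])
  have ball_E: "(\<forall>e\<in>E. P e) \<longleftrightarrow> (\<forall>j\<in>{1..p}. P (Inl j)) \<and> (\<forall>k\<in>A. P (Inr (Inl k))) \<and> (\<forall>k\<in>B. P (Inr (Inr k)))" for P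
    by (simp add: E_def Plus_def ball_Un)
  have image_E: "(\<lambda>e. gradient (F e) x) ` E = (\<lambda>j. gradient (h j) x) ` {1..p} \<union>
      (\<lambda>k. gradient (G k) x) ` A \<union> (\<lambda>k. gradient (H k) x) ` B" for x
    by (simp add: E_def F_def Plus_def image_Un image_image Un_assoc)
  have fin_IE: "finite I" "finite E" using fin by (simp_all add: I_def I_g_def E_def)
  have I_sub: "I \<subseteq> {1..m}" by (auto simp: I_def I_g_def)
  have C1_all: "\<forall>i\<in>{1..m}. C1_with_gradient (g i) (gradient (g i))"
    using g twice_continuously_differentiable_imp_C1 by blast
  have C1_F: "\<forall>e\<in>E. C1_with_gradient (F e) (gradient (F e))"
    unfolding ball_E using AB h G H
    by (auto simp: F_def intro!: twice_continuously_differentiable_imp_C1)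
  interpret constant_rank_constraints I E g "\<lambda>i. gradient (g i)" F "\<lambda>e. gradient (F e)" xb J
  proof
    show "\<forall>\<^sub>F x in nhds xb. dim ((\<lambda>i. gradient (g i) x) ` J \<union> (\<lambda>e. gradient (F e) x) ` E) =
        dim ((\<lambda>i. gradient (g i) xb) ` J \<union> (\<lambda>e. gradient (F e) xb) ` E)"
    proof -
      define D where "D x = dim ((\<lambda>i. gradient (g i) x) ` J \<union> (\<lambda>e. gradient (F e) x) ` E)" for x
      have D: "D = (\<lambda>x. dim ((\<lambda>i. gradient (g i) x) ` J \<union> (\<lambda>j. gradient (h j) x) ` {1..p} \<union>
          (\<lambda>k. gradient (G k) x) ` A \<union> (\<lambda>k. gradient (H k) x) ` B))"
        unfolding D_def image_E by (simp only: Un_assoc)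
      have "\<exists>\<epsilon>>0. D constant_on ball xb \<epsilon>"
        using pcrsc \<beta> unfolding mpsc_pcrsc_def D J[symmetric] A B by fastforce
      then obtain \<epsilon> c where "\<epsilon> > 0" and c: "\<forall>x\<in>ball xb \<epsilon>. D x = c"
        unfolding constant_on_def by blast
      have "D xb = c" using c \<open>\<epsilon> > 0\<close> by simp
      with c \<open>\<epsilon> > 0\<close> have "\<forall>\<^sub>F x in nhds xb. D x = D xb"
        unfolding eventually_nhds_metric by (auto simp: dist_commute)
      then show ?thesis unfolding D_def .
    qed
    show "F e xb = 0" if "e \<in> E" for e
    proof -
      have "\<forall>e\<in>E. F e xb = 0"
        using feas \<beta> unfolding ball_E
        by (auto simp: F_def A B mpsc_feasible_def bipartitions_def I_G_def I_H_def I_GH_def)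
      with that show ?thesis by blast
    qed
  qed (use fin_IE I_sub C1_all C1_F in \<open>auto simp: I_def I_g_def J_def\<close>)
  define S where "S x = (\<Sum>i=1..m. (max (g i x) 0)\<^sup>2) + (\<Sum>j=1..p. (h j x)\<^sup>2) +
      ((\<Sum>k\<in>A. (G k x)\<^sup>2) + (\<Sum>k\<in>B. (H k x)\<^sup>2))" for x
  have S: "S x = (\<Sum>i=1..m. (max (g i x) 0)\<^sup>2) + (\<Sum>e\<in>E. (F e x)\<^sup>2)" for x
    using fin by (simp add: S_def E_def F_def sum.Plus)
  define n where "n = real (card I + card E)"
  have violation_le: "violation x \<le> n * sqrt (S x)" for x
  proof -
    have pos: "0 \<le> (\<Sum>i=1..m. (max (g i x) 0)\<^sup>2)" "0 \<le> (\<Sum>e\<in>E. (F e x)\<^sup>2)"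
      by (simp_all add: sum_nonneg)
    have "max (g i x) 0 \<le> sqrt (S x)" if "i \<in> I" for i
    proof (rule real_le_rsqrt)
      have "(max (g i x) 0)\<^sup>2 \<le> (\<Sum>i=1..m. (max (g i x) 0)\<^sup>2)"
        using that I_sub by (intro member_le_sum) auto
      with pos show "(max (g i x) 0)\<^sup>2 \<le> S x" unfolding S by linarith
    qed
    moreover have "\<bar>F e x\<bar> \<le> sqrt (S x)" if "e \<in> E" for e
    proof (rule real_le_rsqrt)
      have "(F e x)\<^sup>2 \<le> (\<Sum>e\<in>E. (F e x)\<^sup>2)"
        using that fin_IE by (intro member_le_sum) auto
      with pos show "\<bar>F e x\<bar>\<^sup>2 \<le> S x" unfolding S by simp
    qed
    ultimately have "violation x \<le> (\<Sum>i\<in>I. sqrt (S x)) + (\<Sum>e\<in>E. sqrt (S x))"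
      unfolding violation_def by (intro add_mono sum_mono)
    then show ?thesis by (simp add: n_def algebra_simps)
  qed
  obtain C where "C > 0" and C: "\<forall>\<eta>>0. \<forall>\<^sub>F x in nhds xb. \<exists>x'\<in>ball xb \<eta>.
     (\<forall>i\<in>I. g i x' \<le> 0) \<and> (\<forall>e\<in>E. F e x' = 0) \<and> dist x x' \<le> C * violation x"
    using error_bound by blast
  obtain \<epsilon>0 where "\<epsilon>0 > 0" and min: "\<forall>y\<in>mpsc_feasible m p l g h G H. dist y xb < \<epsilon>0 \<longrightarrow> f xb \<le> f y"
    using opt unfolding locally_optimal_def by blast
  have "\<forall>i\<in>{1..m} - I. \<forall>\<^sub>F x in nhds xb. g i x < 0"
  proof
    fix i assume i: "i \<in> {1..m} - I"
    then have "g i xb < 0" using feas by (auto simp: I_def I_g_def mpsc_feasible_def less_le)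
    moreover have "(g i \<longlongrightarrow> g i xb) (nhds xb)"
      using C1_isCont[of "g i" "gradient (g i)" xb] C1_all i unfolding isCont_def tendsto_at_iff_tendsto_nhds by blast
    ultimately show "\<forall>\<^sub>F x in nhds xb. g i x < 0" by (intro order_tendstoD)
  qed
  then have "\<forall>\<^sub>F x in nhds xb. \<forall>i\<in>{1..m} - I. g i x < 0"
    by (intro eventually_ball_finite) auto
  then obtain r where "r > 0" and r: "\<And>x. dist x xb < r \<Longrightarrow> \<forall>i\<in>{1..m} - I. g i x < 0"
    unfolding eventually_nhds_metric by blast
  obtain \<delta> where "\<delta> > 0" and \<delta>: "\<And>x y. \<lbrakk>x \<in> ball xb \<delta>; y \<in> ball xb \<delta>\<rbrakk> \<Longrightarrow>
      \<bar>f x - f y - gradient f xb \<bullet> (x - y)\<bar> \<le> 1 * norm (x - y)"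
    by (rule C1_strict_derivative[OF twice_continuously_differentiable_imp_C1[OF f] zero_less_one, of xb]) auto
  define L where "L = norm (gradient f xb) + 1"
  have "L > 0" by (simp add: L_def add_nonneg_pos)
  have Lip: "f y \<le> f x + L * dist x y" if "x \<in> ball xb \<delta>" "y \<in> ball xb \<delta>" for x y
    using \<delta>[OF that(2,1)] norm_cauchy_schwarz[of "gradient f xb" "y - x"]
    by (simp add: L_def dist_norm norm_minus_commute algebra_simps)
  define \<eta> where "\<eta> = min \<epsilon>0 (min r \<delta>)"
  have "\<eta> > 0" using \<open>\<epsilon>0 > 0\<close> \<open>r > 0\<close> \<open>\<delta> > 0\<close> by (simp add: \<eta>_def)
  have "\<forall>\<^sub>F x in nhds xb. dist x xb < \<delta>"
    using \<open>\<delta> > 0\<close> by (auto simp: eventually_nhds_metric)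
  with C[rule_format, OF \<open>\<eta> > 0\<close>]
  have "\<forall>\<^sub>F x in nhds xb. f xb \<le> f x + L * C * n * sqrt (S x)"
  proof eventually_elim
    case (elim x)
    obtain x' where x': "x' \<in> ball xb \<eta>" "\<forall>i\<in>I. g i x' \<le> 0" "\<forall>e\<in>E. F e x' = 0"
      and dist: "dist x x' \<le> C * violation x"
      using elim(1) by blast
    have near: "dist x' xb < \<epsilon>0" "dist x' xb < r" "x' \<in> ball xb \<delta>"
      using x'(1) by (simp_all add: \<eta>_def dist_commute)
    have "\<forall>i\<in>{1..m}. g i x' \<le> 0"
      using r[OF near(2)] x'(2) by (force intro: less_imp_le)
    moreover have eqs: "\<forall>j\<in>{1..p}. h j x' = 0" "\<forall>k\<in>A. G k x' = 0" "\<forall>k\<in>B. H k x' = 0"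
      using x'(3) unfolding ball_E F_def by simp_all
    moreover have "\<forall>k\<in>{1..l}. G k x' * H k x' = 0"
      unfolding AB[symmetric] using eqs by auto
    ultimately have "x' \<in> mpsc_feasible m p l g h G H" by (simp add: mpsc_feasible_def)
    then have "f xb \<le> f x'" using min near(1) by blast
    also have "\<dots> \<le> f x + L * dist x x'"
      using elim(2) near(3) by (intro Lip) (auto simp: dist_commute)
    also have "\<dots> \<le> f x + L * (C * (n * sqrt (S x)))"
    proof -
      have "dist x x' \<le> C * (n * sqrt (S x))"
        using dist mult_left_mono[OF violation_le[of x], of C] \<open>C > 0\<close> by linarith
      from mult_left_mono[OF this, of L] \<open>L > 0\<close> show ?thesis by linarith
    qed
    finally show ?case by (simp add: mult.assoc)
  qed
  then show ?thesis unfolding S_def by blast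
qed

theorem corollary6p2:
  fixes m p l :: nat
    and f :: "real^'n \<Rightarrow> real"
    and g h G H :: "nat \<Rightarrow> real^'n \<Rightarrow> real"
    and xb :: "real^'n"
  assumes "twice_continuously_differentiable f"
    and "\<forall>i\<in>{1..m}. twice_continuously_differentiable (g i)"
    and "\<forall>j\<in>{1..p}. twice_continuously_differentiable (h j)"
    and "\<forall>k\<in>{1..l}. twice_continuously_differentiable (G k)"
    and "\<forall>k\<in>{1..l}. twice_continuously_differentiable (H k)"
    and "locally_optimal f (mpsc_feasible m p l g h G H) xb"
    and "mpsc_pcrsc m p l g h G H xb"
  shows "\<exists>\<kappa>b>0. \<forall>\<kappa>>\<kappa>b.
           locally_optimal (penalty_objective m p l f g h G H \<kappa>) UNIV xb"
proof -
  let ?IG = "I_G l G H xb" and ?IH = "I_H l G H xb" and ?IGH = "I_GH l G H xb"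
  let ?S = "\<lambda>\<beta>1 \<beta>2 x. (\<Sum>i=1..m. (max (g i x) 0)\<^sup>2) + (\<Sum>j=1..p. (h j x)\<^sup>2) +
      ((\<Sum>k\<in>?IG \<union> \<beta>1. (G k x)\<^sup>2) + (\<Sum>k\<in>?IH \<union> \<beta>2. (H k x)\<^sup>2))"
  have feas: "xb \<in> mpsc_feasible m p l g h G H"
    using assms(6) by (simp add: locally_optimal_def)
  have fin_parts: "finite (bipartitions ?IGH)"
  proof (rule finite_subset)
    show "bipartitions ?IGH \<subseteq> Pow ?IGH \<times> Pow ?IGH" by (auto simp: bipartitions_def)
  qed (simp add: I_GH_def)
  have "\<forall>b\<in>bipartitions ?IGH. \<exists>\<kappa>. \<forall>\<^sub>F x in nhds xb. f xb \<le> f x + \<kappa> * sqrt (?S (fst b) (snd b) x)"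
  proof
    fix b assume b: "b \<in> bipartitions ?IGH"
    show "\<exists>\<kappa>. \<forall>\<^sub>F x in nhds xb. f xb \<le> f x + \<kappa> * sqrt (?S (fst b) (snd b) x)"
      by (rule branch_exact_penalty[OF assms _ refl refl]) (use b in simp)
  qed
  then obtain c where "\<forall>b\<in>bipartitions ?IGH. \<forall>\<^sub>F x in nhds xb. f xb \<le> f x + c b * sqrt (?S (fst b) (snd b) x)"
    by (rule bchoice[THEN exE])
  then have branches: "\<forall>\<^sub>F x in nhds xb. \<forall>b\<in>bipartitions ?IGH. f xb \<le> f x + c b * sqrt (?S (fst b) (snd b) x)"
    using fin_parts by (intro eventually_ball_finite)
  define \<kappa>b where "\<kappa>b = Max (insert 1 (c ` bipartitions ?IGH))"
  have \<kappa>b: "c b \<le> \<kappa>b" if "b \<in> bipartitions ?IGH" for b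
    unfolding \<kappa>b_def using that fin_parts by (intro Max_ge) auto
  have "1 \<le> \<kappa>b" unfolding \<kappa>b_def using fin_parts by (intro Max_ge) auto
  \<comment> \<open>Near \<open>xb\<close> the minimum of \<open>G\<^sub>k\<^sup>2\<close> and \<open>H\<^sub>k\<^sup>2\<close> for \<open>k\<close> in \<open>I_G\<close> or \<open>I_H\<close> is attained by the
    function that vanishes at \<open>xb\<close>.\<close>
  have dominated: "\<forall>\<^sub>F x in nhds xb. \<forall>k\<in>K. \<bar>U k x\<bar> < \<bar>V k x\<bar>"
    if "K \<subseteq> {1..l}" "\<forall>k\<in>K. U k xb = 0 \<and> V k xb \<noteq> 0"
      "\<forall>k\<in>{1..l}. twice_continuously_differentiable (U k)" "\<forall>k\<in>{1..l}. twice_continuously_differentiable (V k)"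
    for K and U V :: "nat \<Rightarrow> real^'n \<Rightarrow> real"
  proof (rule eventually_ball_finite)
    show "finite K" using that(1) finite_subset by blast
    show "\<forall>k\<in>K. \<forall>\<^sub>F x in nhds xb. \<bar>U k x\<bar> < \<bar>V k x\<bar>"
    proof
      fix k assume k: "k \<in> K"
      then have "isCont (\<lambda>x. \<bar>V k x\<bar> - \<bar>U k x\<bar>) xb"
        using that(1,3,4) by (intro continuous_intros C1_isCont[OF twice_continuously_differentiable_imp_C1]) auto
      then have "((\<lambda>x. \<bar>V k x\<bar> - \<bar>U k x\<bar>) \<longlongrightarrow> \<bar>V k xb\<bar> - \<bar>U k xb\<bar>) (nhds xb)"
        unfolding isCont_def by (rule tendsto_at_iff_tendsto_nhds[THEN iffD1])
      then have "\<forall>\<^sub>F x in nhds xb. 0 < \<bar>V k x\<bar> - \<bar>U k x\<bar>"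
        using that(2) k by (intro order_tendstoD) auto
      then show "\<forall>\<^sub>F x in nhds xb. \<bar>U k x\<bar> < \<bar>V k x\<bar>" by eventually_elim simp
    qed
  qed
  have "\<forall>\<^sub>F x in nhds xb. \<forall>k\<in>?IG. \<bar>G k x\<bar> < \<bar>H k x\<bar>"
    by (rule dominated) (use assms in \<open>auto simp: I_G_def\<close>)
  moreover have "\<forall>\<^sub>F x in nhds xb. \<forall>k\<in>?IH. \<bar>H k x\<bar> < \<bar>G k x\<bar>"
    by (rule dominated) (use assms in \<open>auto simp: I_H_def\<close>)
  ultimately have "\<forall>\<^sub>F x in nhds xb. \<forall>\<kappa>>\<kappa>b. f xb \<le> penalty_objective m p l f g h G H \<kappa> x"
    using branches
  proof eventually_elim
    case (elim x)
    \<comment> \<open>The branch whose violation the penalty term measures at \<open>x\<close>.\<close>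
    define \<beta>1 where "\<beta>1 = {k \<in> ?IGH. \<bar>G k x\<bar> \<le> \<bar>H k x\<bar>}"
    define \<beta>2 where "\<beta>2 = ?IGH - \<beta>1"
    let ?A = "?IG \<union> \<beta>1" and ?B = "?IH \<union> \<beta>2"
    have \<beta>: "(\<beta>1, \<beta>2) \<in> bipartitions ?IGH" by (auto simp: bipartitions_def \<beta>1_def \<beta>2_def)
    have "{1..l} = ?A \<union> ?B"
      using feas by (auto simp: \<beta>1_def \<beta>2_def mpsc_feasible_def I_G_def I_H_def I_GH_def)
    moreover have "?A \<inter> ?B = {}"
      by (auto simp: \<beta>1_def \<beta>2_def I_G_def I_H_def I_GH_def)
    moreover have "finite ?A" "finite ?B"
      by (auto simp: \<beta>1_def \<beta>2_def I_G_def I_H_def I_GH_def)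
    ultimately have "(\<Sum>k=1..l. min ((G k x)\<^sup>2) ((H k x)\<^sup>2)) =
        (\<Sum>k\<in>?A. min ((G k x)\<^sup>2) ((H k x)\<^sup>2)) + (\<Sum>k\<in>?B. min ((G k x)\<^sup>2) ((H k x)\<^sup>2))"
      by (simp add: sum.union_disjoint)
    also have "(\<Sum>k\<in>?A. min ((G k x)\<^sup>2) ((H k x)\<^sup>2)) = (\<Sum>k\<in>?A. (G k x)\<^sup>2)"
    proof (intro sum.cong refl)
      fix k assume "k \<in> ?A"
      then have "\<bar>G k x\<bar> \<le> \<bar>H k x\<bar>" using elim(1) by (auto simp: \<beta>1_def less_imp_le)
      then show "min ((G k x)\<^sup>2) ((H k x)\<^sup>2) = (G k x)\<^sup>2" by (simp add: abs_le_square_iff)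
    qed
    also have "(\<Sum>k\<in>?B. min ((G k x)\<^sup>2) ((H k x)\<^sup>2)) = (\<Sum>k\<in>?B. (H k x)\<^sup>2)"
    proof (intro sum.cong refl)
      fix k assume "k \<in> ?B"
      then have "\<bar>H k x\<bar> \<le> \<bar>G k x\<bar>" using elim(2) by (auto simp: \<beta>1_def \<beta>2_def less_imp_le)
      then show "min ((G k x)\<^sup>2) ((H k x)\<^sup>2) = (H k x)\<^sup>2" by (simp add: abs_le_square_iff)
    qed
    finally have pen: "penalty_objective m p l f g h G H \<kappa> x = f x + \<kappa> * sqrt (?S \<beta>1 \<beta>2 x)" for \<kappa>
      by (simp add: penalty_objective_def)
    show ?case
    proof (intro allI impI)
      fix \<kappa> assume "\<kappa> > \<kappa>b"
      have "f xb \<le> f x + c (\<beta>1, \<beta>2) * sqrt (?S \<beta>1 \<beta>2 x)" using elim(3)[THEN bspec, OF \<beta>] by simp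
      also have "\<dots> \<le> f x + \<kappa> * sqrt (?S \<beta>1 \<beta>2 x)"
        using \<kappa>b[OF \<beta>] \<open>\<kappa> > \<kappa>b\<close> by (intro add_left_mono mult_right_mono) (auto intro!: add_nonneg_nonneg sum_nonneg)
      finally show "f xb \<le> penalty_objective m p l f g h G H \<kappa> x" unfolding pen .
    qed
  qed
  moreover have "penalty_objective m p l f g h G H \<kappa> xb = f xb" for \<kappa>
  proof -
    have "min ((G k xb)\<^sup>2) ((H k xb)\<^sup>2) = 0" if "k \<in> {1..l}" for k
    proof -
      have "G k xb = 0 \<or> H k xb = 0" using feas that by (simp add: mpsc_feasible_def)
      then show ?thesis by (auto simp: min_def)
    qed
    then show ?thesis using feas by (simp add: penalty_objective_def mpsc_feasible_def)
  qed
  ultimately obtain \<epsilon> where "\<epsilon> > 0" and \<epsilon>: "\<And>x \<kappa>. \<lbrakk>dist x xb < \<epsilon>; \<kappa> > \<kappa>b\<rbrakk> \<Longrightarrow>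
      penalty_objective m p l f g h G H \<kappa> xb \<le> penalty_objective m p l f g h G H \<kappa> x"
    unfolding eventually_nhds_metric by auto
  then have "\<forall>\<kappa>>\<kappa>b. locally_optimal (penalty_objective m p l f g h G H \<kappa>) UNIV xb"
    unfolding locally_optimal_def by blast
  with \<open>1 \<le> \<kappa>b\<close> show ?thesis by (intro exI[of _ \<kappa>b]) auto
qed

end
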